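(* Let $R>1$ and $\theta\in(-\pi/2,\pi/2)$, $\theta\neq0$, satisfy $1<R\cos\theta\le \frac32$, put $b=1-Re^{i\theta}$, and let $F_n$, $n\ge1$, be the Faber polynomials of the Joukowski airfoil $K$ with parameters $R,\theta$. Then all zeros of $F_n$ approach $\mathcal A$ as $n\to\infty$ (that is, for every open neighborhood $N$ of $\mathcal A$, all zeros of $F_n$ lie in $N$ for all sufficiently large $n$), and $$\lim_{n\to\infty}\mu_n=(U^{-1})_*(\mu_{[-1,1]})\quad\text{weak-*},$$ where $\mu_n$ is the normalized counting measure of the zeros of $F_n$.
   Context: Let $J(\zeta)=\frac12(\zeta+1/\zeta)$ and, for $R>1$, $\theta\in(-\pi/2,\pi/2)$ with $R\cos\theta>1$, let $a=Re^{i\theta}$, $b=1-Re^{i\theta}$ (so $\operatorname{Re}b<0$), $T(z)=az+b$ and $\Psi=J\circ T$. The map $\Psi$ is a conformal map of $\{|z|>1\}\cup\{\infty\}$ onto $\overline{\mathbb C}\setminus K$ with $\Psi(\infty)=\infty$, where $K$ is a compact set called the Joukowski airfoil with parameters $R,\theta$. The Faber polynomials $F_n$ of $K$ are defined, for $|w|$ large, by $$\frac{\Psi'(w)}{\Psi(w)-z}=\sum_{n=0}^\infty\frac{F_n(z)}{w^{n+1}};$$ $F_n$ is a polynomial of degree $n$ (normalizing $\Psi'(\infty)>0$ instead would only multiply $F_n$ by a constant of modulus one). If $z_1^{(n)},\dots,z_n^{(n)}$ are its zeros (with multiplicity), then $\mu_n=\frac1n\sum_{j=1}^n\delta_{z_j^{(n)}}$.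 Let $V(z)=b^2+1-2bz$, $c=\frac12(b+\frac1b)$ (so $V(c)=0$), and $$U(z)=\frac{z-b}{V(z)^{1/2}},\qquad \mathcal A=\{z\in\mathbb C:\ U(z)\in[-1,1]\}$$ (the set $\mathcal A$ does not depend on the choice of the square root). Since $b$ is non-real here, $\mathcal A$ is a simple arc joining $-1$ and $1$ and not containing $c$; the branch of $V^{1/2}$ is taken holomorphic outside a cut from $c$ to $\infty$ that avoids $\mathcal A$, with $V(1)^{1/2}=1-b$. Then $U$ is a bijection from $\mathcal A$ onto $[-1,1]$ with $U(\pm1)=\pm1$, and $U^{-1}:[-1,1]\to\mathcal A$ denotes its inverse. The measure $\mu_{[-1,1]}=\frac1\pi\frac{dx}{\sqrt{1-x^2}}$ is the equilibrium measure of $[-1,1]$, and $f_*(\nu)$ denotes the push-forward of the measure $\nu$ by the map $f$. *)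

theory Defs
  imports "HOL-Analysis.Analysis"
begin

definition joukowski :: "complex \<Rightarrow> complex" where
  "joukowski \<zeta> = (\<zeta> + 1 / \<zeta>) / 2"

definition airfoil_a :: "real \<Rightarrow> real \<Rightarrow> complex" where
  "airfoil_a R \<theta> = of_real R * exp (\<i> * of_real \<theta>)"

definition airfoil_b :: "real \<Rightarrow> real \<Rightarrow> complex" where
  "airfoil_b R \<theta> = 1 - of_real R * exp (\<i> * of_real \<theta>)"

definition airfoil_map :: "real \<Rightarrow> real \<Rightarrow> complex \<Rightarrow> complex" where
  "airfoil_map R \<theta> z = joukowski (airfoil_a R \<theta> * z + airfoil_b R \<theta>)"

definition joukowski_airfoil :: "real \<Rightarrow> real \<Rightarrow> complex set" where
  "joukowski_airfoil R \<theta> = - airfoil_map R \<theta> ` {z. norm z > 1}"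

text \<open>Conformal map of the exterior of the unit disc, together with infinity, onto the complement
  of K in the Riemann sphere, fixing infinity. The point at infinity is encoded by a limit.\<close>

definition exterior_map :: "complex set \<Rightarrow> (complex \<Rightarrow> complex) \<Rightarrow> bool" where
  "exterior_map K \<Psi> \<longleftrightarrow> compact K \<and> \<Psi> holomorphic_on {z. norm z > 1} \<and>
     inj_on \<Psi> {z. norm z > 1} \<and> \<Psi> ` {z. norm z > 1} = - K \<and> filterlim \<Psi> at_infinity at_infinity"

text \<open>How large w has to be depends on z.\<close>

definition faber_polynomials ::
    "complex set \<Rightarrow> (complex \<Rightarrow> complex) \<Rightarrow> (nat \<Rightarrow> complex poly) \<Rightarrow> bool" where
  "faber_polynomials K \<Psi> F \<longleftrightarrow> exterior_map K \<Psi> \<and>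
     (\<forall>z. \<forall>\<^sub>F w in at_infinity.
        (\<lambda>n. poly (F n) z / w ^ (n + 1)) sums (deriv \<Psi> w / (\<Psi> w - z)))"

definition airfoil_V :: "complex \<Rightarrow> complex \<Rightarrow> complex" where
  "airfoil_V b z = b\<^sup>2 + 1 - 2 * b * z"

definition airfoil_c :: "complex \<Rightarrow> complex" where
  "airfoil_c b = (b + 1 / b) / 2"

text \<open>Here s is either square root of V(z). The condition that s is nonzero removes the pole c
  of U, which division by zero would otherwise put into the set.\<close>

definition airfoil_arc :: "complex \<Rightarrow> complex set" where
  "airfoil_arc b =
     {z. \<exists>s. s\<^sup>2 = airfoil_V b z \<and> s \<noteq> 0 \<and> (z - b) / s \<in> complex_of_real ` {-1..1}}"

definition cut_to_infinity :: "complex \<Rightarrow> complex set \<Rightarrow> bool" where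
  "cut_to_infinity p \<Gamma> \<longleftrightarrow>
     (\<exists>\<gamma> :: real \<Rightarrow> complex. continuous_on {0..} \<gamma> \<and> inj_on \<gamma> {0..} \<and> \<gamma> 0 = p \<and>
        filterlim \<gamma> at_infinity at_top \<and> \<Gamma> = \<gamma> ` {0..})"

text \<open>S is a branch of the square root of V. For non-real b all such S
  agree on the arc.\<close>

definition airfoil_sqrt_branch :: "complex \<Rightarrow> (complex \<Rightarrow> complex) \<Rightarrow> bool" where
  "airfoil_sqrt_branch b S \<longleftrightarrow>
     (\<exists>\<Gamma>. cut_to_infinity (airfoil_c b) \<Gamma> \<and> \<Gamma> \<inter> airfoil_arc b = {} \<and>
        S holomorphic_on (- \<Gamma>) \<and> (\<forall>z \<in> - \<Gamma>. (S z)\<^sup>2 = airfoil_V b z) \<and> S 1 = 1 - b)"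

definition airfoil_U :: "complex \<Rightarrow> (complex \<Rightarrow> complex) \<Rightarrow> complex \<Rightarrow> complex" where
  "airfoil_U b S z = (z - b) / S z"

definition airfoil_U_inv :: "complex \<Rightarrow> (complex \<Rightarrow> complex) \<Rightarrow> real \<Rightarrow> complex" where
  "airfoil_U_inv b S x = inv_into (airfoil_arc b) (airfoil_U b S) (complex_of_real x)"

text \<open>The equilibrium measure has [-1,1] as its underlying space, so that push-forwards only involve
  maps on [-1,1]. The density is 0 at the endpoints because division by zero gives 0.\<close>

definition equilibrium_measure :: "real measure" where
  "equilibrium_measure =
     density (restrict_space lborel {-1..1}) (\<lambda>x. ennreal (1 / (pi * sqrt (1 - x\<^sup>2))))"

text \<open>Mass (multiplicity of z)/n at each zero z of p; used for p of degree n.\<close>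

definition zero_counting_measure :: "nat \<Rightarrow> complex poly \<Rightarrow> complex measure" where
  "zero_counting_measure n p =
     distr (point_measure {z. poly p z = 0} (\<lambda>z. ennreal (real (order z p) / real n)))
       borel (\<lambda>z. z)"

text \<open>For probability measures with a probability measure as limit, testing with bounded continuous
  functions is equivalent to testing with continuous functions of compact support.\<close>

definition weak_star_limit :: "(nat \<Rightarrow> complex measure) \<Rightarrow> complex measure \<Rightarrow> bool" where
  "weak_star_limit M \<mu> \<longleftrightarrow>
     (\<forall>f :: complex \<Rightarrow> real. continuous_on UNIV f \<and> bounded (range f) \<longrightarrow>
        (\<lambda>n. integral\<^sup>L (M n) f) \<longlonglongrightarrow> integral\<^sup>L \<mu> f)"

text \<open>The map is an exterior map of the airfoil and its Faber polynomials exist, so the conditions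
  collected in the two definitions above are satisfiable for all admissible parameters.
  With 2z = u + 1/u, the n-th Faber polynomial takes the value
  ((u - b)^n + (1/u - b)^n - (-b)^n) / a^n at z.\<close>

lemma joukowski_eq_iff:
  assumes "\<zeta> \<noteq> 0"
  shows "joukowski \<zeta> = z \<longleftrightarrow> \<zeta>\<^sup>2 - 2 * z * \<zeta> + 1 = 0"
  using assms unfolding joukowski_def by (auto simp: field_simps power2_eq_square)

lemma airfoil_parameters:
  assumes "1 < R * cos \<theta>"
  shows "airfoil_a R \<theta> = 1 - airfoil_b R \<theta>" "Re (airfoil_b R \<theta>) < 0" "airfoil_a R \<theta> \<noteq> 0"
proof -
  have "exp (\<i> * of_real \<theta>) = cis \<theta>" by (simp add: cis_conv_exp)
  then show "airfoil_a R \<theta> = 1 - airfoil_b R \<theta>" "Re (airfoil_b R \<theta>) < 0" "airfoil_a R \<theta> \<noteq> 0"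
    using assms by (auto simp: airfoil_a_def airfoil_b_def)
qed

lemma norm_sub_gt_iff:
  fixes x b :: complex
  shows "norm (x - b) > norm (1 - b) \<longleftrightarrow>
    (Re x)\<^sup>2 + (Im x)\<^sup>2 - 2 * Re b * Re x - 2 * Im b * Im x > 1 - 2 * Re b"
  unfolding cmod_def real_sqrt_less_iff by (simp add: power2_eq_square algebra_simps)

lemma outside_nonzero:
  fixes x b :: complex
  assumes "Re b < 0" "norm (x - b) > norm (1 - b)"
  shows "x \<noteq> 0"
  using assms by (auto simp: norm_sub_gt_iff)

lemma outside_inverse:
  fixes x b :: complex
  assumes b: "Re b < 0" and x: "norm (x - b) > norm (1 - b)"
  shows "norm (1 / x - b) < norm (1 - b)"
proof -
  define s t \<beta> \<eta> where d: "s = Re x" "t = Im x" "\<beta> = Re b" "\<eta> = Im b"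
  define r where "r = s\<^sup>2 + t\<^sup>2"
  have "x \<noteq> 0" using outside_nonzero[OF b x] .
  then have r: "r > 0" unfolding r_def d by (simp add: complex_eq_iff sum_power2_gt_zero_iff)
  have X: "r - 2 * \<beta> * s - 2 * \<eta> * t > 1 - 2 * \<beta>"
    using x unfolding norm_sub_gt_iff r_def d by simp
  have "\<beta> * ((s - 1)\<^sup>2 + t\<^sup>2) \<le> 0" using b unfolding d by (simp add: mult_nonpos_nonneg)
  then have Y: "1 - 2 * \<beta> * s + 2 * \<eta> * t < (1 - 2 * \<beta>) * r"
    using X unfolding r_def by (simp add: power2_eq_square algebra_simps)
  have re: "Re (1 / x) = s / r" "Im (1 / x) = - t / r"
    by (simp_all add: Re_divide Im_divide r_def d)
  have "(norm (1 / x - b))\<^sup>2 = (s / r - \<beta>)\<^sup>2 + (- t / r - \<eta>)\<^sup>2"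
    unfolding cmod_power2 minus_complex.simps re d by simp
  also have "\<dots> = (s\<^sup>2 + t\<^sup>2) / r\<^sup>2 - 2 * \<beta> * s / r + 2 * \<eta> * t / r + \<beta>\<^sup>2 + \<eta>\<^sup>2"
    using r by (simp add: power2_eq_square field_simps)
  also have "\<dots> = (1 - 2 * \<beta> * s + 2 * \<eta> * t) / r + \<beta>\<^sup>2 + \<eta>\<^sup>2"
    unfolding r_def[symmetric] using r by (simp add: power2_eq_square field_simps)
  also have "\<dots> < (1 - 2 * \<beta>) + \<beta>\<^sup>2 + \<eta>\<^sup>2"
    using Y r by (simp add: pos_divide_less_eq)
  also have "\<dots> = (norm (1 - b))\<^sup>2"
    unfolding cmod_power2 d by (simp add: power2_eq_square algebra_simps)
  finally show ?thesis by (simp add: power2_less_imp_less)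
qed

lemma airfoil_map_exterior:
  assumes "1 < R * cos \<theta>"
  shows "exterior_map (joukowski_airfoil R \<theta>) (airfoil_map R \<theta>)"
proof -
  define a b where ab: "a = airfoil_a R \<theta>" "b = airfoil_b R \<theta>"
  define E where "E = {z::complex. norm z > 1}"
  have a: "a = 1 - b" "a \<noteq> 0" and b: "Re b < 0"
    using airfoil_parameters[OF assms] unfolding ab by auto
  have map: "airfoil_map R \<theta> = (\<lambda>w. joukowski (a * w + b))"
    unfolding airfoil_map_def ab by auto
  have out: "norm (a * w + b - b) > norm (1 - b) \<longleftrightarrow> w \<in> E" for w
    using a unfolding E_def by (simp add: norm_mult)
  have nz: "a * w + b \<noteq> 0" if "w \<in> E" for w
    using outside_nonzero[OF b] that out by blast
  have openE: "open E" unfolding E_def by (intro open_Collect_less continuous_intros)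
  have hol: "airfoil_map R \<theta> holomorphic_on E"
    unfolding map joukowski_def using nz by (intro holomorphic_intros) auto
  have inj: "inj_on (airfoil_map R \<theta>) E"
  proof (rule inj_onI)
    fix v w assume v: "v \<in> E" and w: "w \<in> E" and eq: "airfoil_map R \<theta> v = airfoil_map R \<theta> w"
    define x y where xy: "x = a * v + b" "y = a * w + b"
    have "x \<noteq> 0" "y \<noteq> 0" using nz v w unfolding xy by auto
    moreover have "x + 1 / x = y + 1 / y"
      using eq unfolding map joukowski_def xy[symmetric] divide_cancel_right by simp
    ultimately have "(x - y) * (x * y - 1) = 0" by (simp add: field_simps)
    moreover have "x * y \<noteq> 1"
    proof
      assume "x * y = 1"
      then have "y = 1 / x" using \<open>x \<noteq> 0\<close> by (simp add: field_simps)
      moreover have "norm (1 / x - b) < norm (1 - b)"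
        using outside_inverse[OF b] out v unfolding xy by blast
      ultimately show False using out[of w] w unfolding xy by auto
    qed
    ultimately show "v = w" using a unfolding xy by auto
  qed
  have lim: "filterlim (airfoil_map R \<theta>) at_infinity at_infinity"
  proof -
    have 1: "filterlim (\<lambda>w. a * w + b) at_infinity at_infinity"
      using a(2) by (intro tendsto_add_filterlim_at_infinity'[OF _ tendsto_const]
          tendsto_mult_filterlim_at_infinity[OF tendsto_const] filterlim_ident) auto
    have 2: "filterlim (\<lambda>x::complex. x + 1 / x) at_infinity at_infinity"
      using tendsto_add_filterlim_at_infinity'[OF filterlim_ident tendsto_inverse_0]
      by (simp add: inverse_eq_divide)
    have 3: "filterlim (\<lambda>x::complex. (1/2) * x) at_infinity at_infinity"
      by (intro tendsto_mult_filterlim_at_infinity[OF tendsto_const] filterlim_ident) auto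
    show ?thesis
      using filterlim_compose[OF filterlim_compose[OF 3 2] 1] unfolding map joukowski_def by simp
  qed
  have "closed (joukowski_airfoil R \<theta>)"
    unfolding joukowski_airfoil_def E_def[symmetric] closed_def double_compl
    by (rule invariance_of_domain[OF holomorphic_on_imp_continuous_on[OF hol] openE inj])
  moreover have "bounded (joukowski_airfoil R \<theta>)"
  proof (rule boundedI)
    fix z assume z: "z \<in> joukowski_airfoil R \<theta>"
    define s where "s = csqrt (z\<^sup>2 - 1)"
    define u v where uv: "u = z + s" "v = z - s"
    have s: "s\<^sup>2 = z\<^sup>2 - 1" unfolding s_def by simp
    have inside: "norm (x - b) \<le> norm (1 - b)" if "x\<^sup>2 - 2 * z * x + 1 = 0" for x
    proof (rule ccontr)
      assume n: "\<not> ?thesis"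
      define w where "w = (x - b) / a"
      have x: "x = a * w + b" using a unfolding w_def by simp
      have "w \<in> E" using n out[of w] unfolding x by simp
      moreover have "airfoil_map R \<theta> w = z"
        using that joukowski_eq_iff[of x z] unfolding map x[symmetric] by force
      ultimately show False using z unfolding joukowski_airfoil_def E_def by auto
    qed
    have "norm (u - b) \<le> norm (1 - b)" "norm (v - b) \<le> norm (1 - b)"
      by (rule inside, use s in \<open>simp add: uv power2_eq_square algebra_simps\<close>)+
    moreover have "norm (2 * z - 2 * b) \<le> norm (u - b) + norm (v - b)"
      using norm_triangle_ineq[of "u - b" "v - b"] by (simp add: uv)
    moreover have "norm (2 * z) \<le> norm (2 * z - 2 * b) + norm (2 * b)"
      using norm_triangle_ineq[of "2 * z - 2 * b" "2 * b"] by simp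
    ultimately show "norm z \<le> norm (1 - b) + norm b" by (simp add: norm_mult)
  qed
  ultimately have "compact (joukowski_airfoil R \<theta>)" by (simp add: compact_eq_bounded_closed)
  then show ?thesis
    using hol inj lim unfolding exterior_map_def E_def joukowski_airfoil_def by auto
qed

lemma power_sum_poly:
  "\<exists>P. \<forall>u. u \<noteq> 0 \<longrightarrow> poly P (joukowski u) = (u - b) ^ n + (1 / u - b) ^ n"
proof (induction n rule: less_induct)
  case (less n)
  show ?case
  proof (cases "n \<le> 1")
    case True
    then have "n = 0 \<or> n = 1" by auto
    then show ?thesis
      by (auto intro!: exI[of _ "if n = 0 then [:2:] else [:- 2 * b, 2:]"] simp: joukowski_def)
  next
    case False
    then obtain m where n: "n = Suc (Suc m)" by (metis One_nat_def Suc_le_D not_less_eq_eq)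
    obtain P where P: "\<And>u. u \<noteq> 0 \<Longrightarrow> poly P (joukowski u) = (u - b) ^ m + (1 / u - b) ^ m"
      using less[of m] n by auto
    obtain Q where Q: "\<And>u. u \<noteq> 0 \<Longrightarrow> poly Q (joukowski u) = (u - b) ^ Suc m + (1 / u - b) ^ Suc m"
      using less[of "Suc m"] n by auto
    have "poly ([:- 2 * b, 2:] * Q - [:b\<^sup>2 + 1, - 2 * b:] * P) (joukowski u)
        = (u - b) ^ n + (1 / u - b) ^ n" if u: "u \<noteq> 0" for u
    proof -
      define p q where pq: "p = u - b" "q = 1 / u - b"
      have 1: "poly [:- 2 * b, 2:] (joukowski u) = p + q"
        by (simp add: joukowski_def pq)
      have 2: "poly [:b\<^sup>2 + 1, - 2 * b:] (joukowski u) = p * q"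
        using u by (simp add: joukowski_def pq field_simps power2_eq_square)
      show ?thesis
        unfolding poly_diff poly_mult 1 2 P[OF u] Q[OF u] pq[symmetric] n
        by (simp add: algebra_simps)
    qed
    then show ?thesis by blast
  qed
qed

lemma geometric_sums_at_infinity:
  fixes \<alpha> :: complex
  shows "\<forall>\<^sub>F w in at_infinity. (\<lambda>n. \<alpha> ^ n / w ^ (n + 1)) sums (1 / (w - \<alpha>))"
  unfolding eventually_at_infinity
proof (intro exI[of _ "norm \<alpha> + 1"] allI impI)
  fix w :: complex assume w: "norm \<alpha> + 1 \<le> norm w"
  have w0: "w \<noteq> 0" using w norm_ge_zero[of \<alpha>] by (auto simp del: norm_ge_zero)
  then have n: "norm (\<alpha> / w) < 1" using w by (simp add: norm_divide)
  have "(\<lambda>n. (1 / w) * (\<alpha> / w) ^ n) sums ((1 / w) * (1 / (1 - \<alpha> / w)))"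
    by (intro sums_mult geometric_sums n)
  moreover have "(1 / w) * (1 / (1 - \<alpha> / w)) = 1 / (w - \<alpha>)"
    using w w0 by (simp add: field_simps)
  ultimately show "(\<lambda>n. \<alpha> ^ n / w ^ (n + 1)) sums (1 / (w - \<alpha>))"
    by (simp add: power_divide)
qed

lemma airfoil_faber_polynomials_exist:
  assumes "1 < R * cos \<theta>"
  shows "\<exists>F. faber_polynomials (joukowski_airfoil R \<theta>) (airfoil_map R \<theta>) F"
proof -
  define a b where ab: "a = airfoil_a R \<theta>" "b = airfoil_b R \<theta>"
  have a: "a \<noteq> 0" using airfoil_parameters[OF assms] unfolding ab by auto
  obtain P where P: "\<And>n u. u \<noteq> 0 \<Longrightarrow> poly (P n) (joukowski u) = (u - b) ^ n + (1 / u - b) ^ n"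
    using power_sum_poly[of b] by metis
  define F where "F n = smult (1 / a ^ n) (P n - [:(- b) ^ n:])" for n
  have "\<forall>\<^sub>F w in at_infinity. (\<lambda>n. poly (F n) z / w ^ (n + 1)) sums
      (deriv (airfoil_map R \<theta>) w / (airfoil_map R \<theta> w - z))" for z
  proof -
    define u where "u = z + csqrt (z\<^sup>2 - 1)"
    have uz: "u\<^sup>2 - 2 * z * u + 1 = 0"
      unfolding u_def by (simp add: power2_eq_square algebra_simps flip: power2_csqrt)
         (simp add: power2_eq_square[symmetric])
    have u: "u \<noteq> 0" using uz by auto
    have z: "z = joukowski u" using joukowski_eq_iff[OF u, of z] uz by blast
    define \<alpha> \<beta> \<gamma> where d: "\<alpha> = (u - b) / a" "\<beta> = (1 / u - b) / a" "\<gamma> = - b / a"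
    have Fz: "poly (F n) z = \<alpha> ^ n + \<beta> ^ n - \<gamma> ^ n" for n
      unfolding F_def z d power_divide
      by (simp add: P[OF u]) (simp add: add_divide_distrib diff_divide_distrib)
    have ev: "\<forall>\<^sub>F w in at_infinity. w \<noteq> \<alpha> \<and> w \<noteq> \<beta> \<and> w \<noteq> \<gamma>"
      by (intro eventually_conj eventually_not_equal_at_infinity)
    show ?thesis
      using geometric_sums_at_infinity[of \<alpha>] geometric_sums_at_infinity[of \<beta>]
        geometric_sums_at_infinity[of \<gamma>] ev
    proof eventually_elim
      case (elim w)
      define x where "x = a * w + b"
      have x0: "x \<noteq> 0" "x \<noteq> u" "x \<noteq> 1 / u"
        using elim(4) a unfolding d x_def by (auto simp: field_simps eq_neg_iff_add_eq_0)
      have "((\<lambda>w. ((a * w + b) + 1 / (a * w + b)) / 2) has_field_derivative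
          (a - a / x\<^sup>2) / 2) (at w)"
        using x0 unfolding x_def
        by (auto intro!: derivative_eq_intros simp: power2_eq_square)
      then have D: "deriv (airfoil_map R \<theta>) w = (a - a / x\<^sup>2) / 2"
        unfolding airfoil_map_def joukowski_def ab[symmetric] by (intro DERIV_imp_deriv)
      have M: "airfoil_map R \<theta> w - z = (x - u) * (x - 1 / u) / (2 * x)"
        using x0 u unfolding airfoil_map_def z joukowski_def ab[symmetric] x_def[symmetric]
        by (simp add: field_simps power2_eq_square)
      have w: "w - \<alpha> = (x - u) / a" "w - \<beta> = (x - 1 / u) / a" "w - \<gamma> = x / a"
        using a by (simp_all add: d x_def field_simps)
      have "a / p + a / q - a / x = (a - a / x\<^sup>2) / 2 / (p * q / (2 * x))"
        if "p = x - u" "q = x - 1 / u" "p \<noteq> 0" "q \<noteq> 0" for p q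
      proof -
        have "x * (p + q) - p * q = x\<^sup>2 - 1"
        proof -
          have "x * (p + q) - p * q = x\<^sup>2 - u * (1 / u)"
            unfolding that(1,2) power2_eq_square by (simp only: algebra_simps)
          then show ?thesis using u by simp
        qed
        moreover have "a / p + a / q - a / x = a * (x * (p + q) - p * q) / (x * p * q)"
          using x0 that(3,4) by (simp add: field_simps)
        moreover have "(a - a / x\<^sup>2) / 2 / (p * q / (2 * x)) = a * (x\<^sup>2 - 1) / (x * p * q)"
          using x0 that(3,4) by (simp add: field_simps power2_eq_square)
        ultimately show ?thesis by simp
      qed
      from this[of "x - u" "x - 1 / u"]
      have "1 / (w - \<alpha>) + 1 / (w - \<beta>) - 1 / (w - \<gamma>) =
          deriv (airfoil_map R \<theta>) w / (airfoil_map R \<theta> w - z)"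
        unfolding D M w using x0 by simp
      then show ?case
        using sums_diff[OF sums_add[OF elim(1,2)] elim(3)]
        by (simp add: Fz add_divide_distrib diff_divide_distrib)
    qed
  qed
  then show ?thesis
    using airfoil_map_exterior[OF assms] unfolding faber_polynomials_def by blast
qed

end

theory Submission
  imports Defs "HOL-Complex_Analysis.Conformal_Mappings"
begin

text \<open>For a point z let p and q be the two numbers with p + q = 2 (z - b) and p q = V(z); writing
z = J(u), they are u - b and 1/u - b. Expanding the defining generating function into partial
fractions gives (1 - b)^n F_n(z) = p^n + q^n - (-b)^n (\<open>faber_polynomial_eq\<close>). The three terms have
sizes |p|^n, |q|^n and |b|^n, and the zeros lie where no term dominates the other two. The arc is
the set |p| = |q|. The hypothesis on R and \<theta>, which says -1/2 \<le> Re b < 0, ensures that |b| is never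
larger than both |p| and |q|: if |p| \<le> |b| and |q| \<le> |b|, then p = q
(\<open>roots_equal_if_le_norm_b\<close>), and this happens only at the end points of the arc. So off the arc
the larger one of p and q dominates. The domination is uniform off a
neighbourhood of the arc, by compactness for bounded u and directly for large u, so F_n has no zero
there once n is large (\<open>faber_zeros_near_arc\<close>).

For the distribution of the zeros, the inverse of U has the explicit formula
x \<mapsto> b + x (sqrt (1 - b^2 (1 - x^2)) - b x), which is holomorphic near [-1,1]. With x = cos w and s the
value of V^(1/2), one has p = s e^(iw) and q = s e^(-iw), so that
(1 - b)^n F_n = 2 s^n cos(n w) - (-b)^n. On the open arc |b| < |s|; hence, away from the end points,
F_n is up to a factor an exponentially small perturbation of cos(n w). By the minimum modulus
principle there is a zero within distance 1/n of each point w = \<pi> (k + 1/2) / n that stays away from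
0 and \<pi> (\<open>faber_zeros_near_nodes\<close>). These zeros are distinct, and they are all but an arbitrarily
small proportion of the n zeros that F_n has by its degree. Integrals of a test function
against \<mu>_n are therefore close to midpoint Riemann sums, which converge to the mean of the test function over
w in [0,\<pi>]; this mean is the integral against the image of the equilibrium measure, because the
arcsine law is the image of the uniform distribution under the cosine.\<close>

section \<open>The inverse of U on a neighbourhood of the segment\<close>

text \<open>Solving U(z) = x means z = b + x s with s^2 = V(z), that is (s + b x)^2 = 1 - b^2 (1 - x^2). This is
the solution s whose value at x = 1 is 1 - b, as prescribed for V^(1/2).\<close>

definition arc_sqrt :: "complex \<Rightarrow> complex \<Rightarrow> complex" where
  "arc_sqrt b x = csqrt (1 - b\<^sup>2 * (1 - x\<^sup>2)) - b * x"

definition arc_param :: "complex \<Rightarrow> complex \<Rightarrow> complex" where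
  "arc_param b x = b + x * arc_sqrt b x"

text \<open>The set where the radicand avoids the branch cut of \<open>csqrt\<close>. It excludes in particular the branch
points of the inverse of U, where the radicand vanishes.\<close>

definition arc_domain :: "complex \<Rightarrow> complex set" where
  "arc_domain b = {x. 1 - b\<^sup>2 * (1 - x\<^sup>2) \<notin> \<real>\<^sub>\<le>\<^sub>0}"

lemma arc_sqrt_quadratic:
  "(arc_sqrt b x + b * x)\<^sup>2 = 1 - b\<^sup>2 * (1 - x\<^sup>2)"
  by (simp add: arc_sqrt_def)

lemma arc_sqrt_square: "(arc_sqrt b x)\<^sup>2 = airfoil_V b (arc_param b x)"
  using arc_sqrt_quadratic[of b x]
  by (simp add: airfoil_V_def arc_param_def power2_eq_square algebra_simps)

text \<open>If s vanished at x, the quadratic equation for s would read b^2 x^2 = 1 - b^2 (1 - x^2), which forces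
b^2 = 1 whatever x is.\<close>

lemma arc_sqrt_nonzero:
  assumes "b\<^sup>2 \<noteq> 1"
  shows "arc_sqrt b x \<noteq> 0"
proof
  assume "arc_sqrt b x = 0"
  then have "(b * x)\<^sup>2 = 1 - b\<^sup>2 * (1 - x\<^sup>2)"
    using arc_sqrt_quadratic[of b x] by simp
  then show False using assms by (simp add: algebra_simps)
qed

text \<open>The point z determines s up to sign, and x = (z - b) / s. Changing the sign of s changes x to -x, and
the explicit formula for s is consistent with this only at a branch point.\<close>

lemma inj_on_arc_param:
  assumes "b\<^sup>2 \<noteq> 1"
  shows "inj_on (arc_param b) (arc_domain b)"
proof (rule inj_onI)
  fix x y assume x: "x \<in> arc_domain b" and eq: "arc_param b x = arc_param b y"
  have p: "x * arc_sqrt b x = y * arc_sqrt b y"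
    using eq by (simp add: arc_param_def)
  have "(arc_sqrt b x)\<^sup>2 = (arc_sqrt b y)\<^sup>2"
    by (simp only: arc_sqrt_square eq)
  then consider "arc_sqrt b y = arc_sqrt b x" | "arc_sqrt b y = - arc_sqrt b x"
    by (metis power2_eq_iff)
  then show "x = y"
  proof cases
    case 1
    then show ?thesis using p arc_sqrt_nonzero[OF assms] by simp
  next
    case 2
    then have "(x + y) * arc_sqrt b x = 0" using p by (simp add: algebra_simps)
    then have "y = - x"
      using arc_sqrt_nonzero[OF assms, of x] by (simp add: eq_neg_iff_add_eq_0 add.commute)
    then have "csqrt (1 - b\<^sup>2 * (1 - x\<^sup>2)) = 0"
      using 2 by (simp add: arc_sqrt_def)
    then have "1 - b\<^sup>2 * (1 - x\<^sup>2) = 0" by simp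
    then show ?thesis using x by (simp add: arc_domain_def)
  qed
qed

lemma open_arc_domain: "open (arc_domain b)"
proof -
  have "open ((\<lambda>x. 1 - b\<^sup>2 * (1 - x\<^sup>2)) -` (- \<real>\<^sub>\<le>\<^sub>0))"
    by (intro open_vimage open_Compl closed_nonpos_Reals_complex continuous_intros)
  then show ?thesis by (simp add: arc_domain_def vimage_def)
qed

lemma holomorphic_on_arc_sqrt: "arc_sqrt b holomorphic_on arc_domain b"
  unfolding arc_sqrt_def arc_domain_def
  by (intro holomorphic_intros holomorphic_on_csqrt' ) auto

lemma holomorphic_on_arc_param: "arc_param b holomorphic_on arc_domain b"
  unfolding arc_param_def by (intro holomorphic_intros holomorphic_on_arc_sqrt)

text \<open>Since b lies on neither axis, b^2 is not real, so 1 - b^2 t is real only for t = 0.\<close>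

lemma segment_in_arc_domain:
  assumes "Re b \<noteq> 0" "Im b \<noteq> 0" "x \<in> {-1..1}"
  shows "complex_of_real x \<in> arc_domain b"
proof -
  define t where "t = 1 - x\<^sup>2"
  have "1 - b\<^sup>2 * of_real t \<notin> \<real>\<^sub>\<le>\<^sub>0"
  proof
    assume *: "1 - b\<^sup>2 * of_real t \<in> \<real>\<^sub>\<le>\<^sub>0"
    then have "Im (1 - b\<^sup>2 * of_real t) = 0" by (auto simp: complex_nonpos_Reals_iff)
    then have "t = 0" using assms by (simp add: power2_eq_square)
    then show False using * by simp
  qed
  then show ?thesis by (simp add: arc_domain_def t_def)
qed

lemma continuous_on_arc_functions:
  "continuous_on {w. cos w \<in> arc_domain b} (\<lambda>w. arc_param b (cos w))"
  "continuous_on {w. cos w \<in> arc_domain b} (\<lambda>w. arc_sqrt b (cos w))"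
  "open {w. cos w \<in> arc_domain b}"
proof -
  show "open {w. cos w \<in> arc_domain b}"
    using open_vimage[OF open_arc_domain, of cos b] by (simp add: vimage_def continuous_intros)
  show "continuous_on {w. cos w \<in> arc_domain b} (\<lambda>w. arc_param b (cos w))"
    by (rule continuous_on_compose2[OF holomorphic_on_imp_continuous_on[OF holomorphic_on_arc_param]])
      (auto intro: continuous_intros)
  show "continuous_on {w. cos w \<in> arc_domain b} (\<lambda>w. arc_sqrt b (cos w))"
    by (rule continuous_on_compose2[OF holomorphic_on_imp_continuous_on[OF holomorphic_on_arc_sqrt]])
      (auto intro: continuous_intros)
qed

text \<open>The quadratic equation for s has two solutions. The one with the other sign of the square root belongs
to the parameter -x, so it adds no further points.\<close>

lemma arc_param_image:
  assumes b: "b\<^sup>2 \<noteq> 1"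
  shows "arc_param b ` complex_of_real ` {-1..1} = airfoil_arc b"
proof (intro equalityI subsetI)
  fix z assume "z \<in> arc_param b ` complex_of_real ` {-1..1}"
  then obtain x where x: "x \<in> {-1..1}" "z = arc_param b (of_real x)" by auto
  then have "(z - b) / arc_sqrt b (of_real x) = of_real x"
    using arc_sqrt_nonzero[OF b] by (simp add: arc_param_def)
  then show "z \<in> airfoil_arc b"
    using x arc_sqrt_square[of b "of_real x"] arc_sqrt_nonzero[OF b, of "of_real x"]
    unfolding airfoil_arc_def by blast
next
  fix z assume "z \<in> airfoil_arc b"
  then obtain s x where s: "s\<^sup>2 = airfoil_V b z" "s \<noteq> 0"
    and x: "x \<in> {-1..1}" "(z - b) / s = of_real x"
    unfolding airfoil_arc_def by auto
  have z: "z = b + of_real x * s" using s(2) x(2) by (simp add: field_simps)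
  have "(s + b * of_real x)\<^sup>2 = (csqrt (1 - b\<^sup>2 * (1 - (of_real x)\<^sup>2)))\<^sup>2"
    using s(1) unfolding z airfoil_V_def power2_csqrt
    by (simp add: power2_eq_square algebra_simps)
  then consider "s + b * of_real x = csqrt (1 - b\<^sup>2 * (1 - (of_real x)\<^sup>2))"
    | "s + b * of_real x = - csqrt (1 - b\<^sup>2 * (1 - (of_real x)\<^sup>2))"
    by (metis power2_eq_iff)
  then show "z \<in> arc_param b ` complex_of_real ` {-1..1}"
  proof cases
    case 1
    then have "s = arc_sqrt b (of_real x)" by (simp add: arc_sqrt_def eq_diff_eq)
    then have "z = arc_param b (of_real x)" using z by (simp add: arc_param_def)
    then show ?thesis using x(1) by blast
  next
    case 2
    then have "s = - arc_sqrt b (of_real (- x))"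
      by (simp add: arc_sqrt_def algebra_simps eq_neg_iff_add_eq_0)
    then have "z = arc_param b (of_real (- x))" using z by (simp add: arc_param_def)
    moreover have "- x \<in> {-1..1}" using x(1) by simp
    ultimately show ?thesis by blast
  qed
qed

text \<open>Both sides are continuous square roots of V along the arc. Their quotient takes only the values 1
and -1, so it is constant by connectedness, and it is 1 at the end point 1.\<close>

lemma branch_on_arc:
  assumes b: "b\<^sup>2 \<noteq> 1" "Re b \<noteq> 0" "Im b \<noteq> 0" and S: "airfoil_sqrt_branch b S"
    and x: "x \<in> {-1..1}"
  shows "S (arc_param b (of_real x)) = arc_sqrt b (of_real x)"
proof -
  obtain \<Gamma> where G: "\<Gamma> \<inter> airfoil_arc b = {}" "S holomorphic_on (- \<Gamma>)"
    "\<And>z. z \<in> - \<Gamma> \<Longrightarrow> (S z)\<^sup>2 = airfoil_V b z" "S 1 = 1 - b"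
    using S unfolding airfoil_sqrt_branch_def by auto
  define h where "h t = S (arc_param b (of_real t)) / arc_sqrt b (of_real t)" for t :: real
  have arc: "arc_param b (of_real t) \<in> - \<Gamma>" if "t \<in> {-1..1}" for t
    using arc_param_image[OF b(1)] G(1) that by blast
  have dom: "complex_of_real ` {-1..1} \<subseteq> arc_domain b"
    using segment_in_arc_domain[OF b(2,3)] by blast
  have "continuous_on {-1..1} (\<lambda>t. arc_param b (complex_of_real t))"
    by (rule continuous_on_compose2[OF holomorphic_on_imp_continuous_on[OF holomorphic_on_arc_param] _ dom])
      (intro continuous_intros)
  moreover have cs: "continuous_on {-1..1} (\<lambda>t. arc_sqrt b (complex_of_real t))"
    by (rule continuous_on_compose2[OF holomorphic_on_imp_continuous_on[OF holomorphic_on_arc_sqrt] _ dom])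
      (intro continuous_intros)
  ultimately have ch: "continuous_on {-1..1} h"
    unfolding h_def using arc_sqrt_nonzero[OF b(1)] arc
    by (intro continuous_intros continuous_on_compose2[OF holomorphic_on_imp_continuous_on[OF G(2)]]) auto
  have sq: "h t = 1 \<or> h t = -1" if "t \<in> {-1..1}" for t
  proof -
    have "(h t)\<^sup>2 = 1"
      using arc_sqrt_nonzero[OF b(1), of "of_real t"] G(3)[OF arc[OF that]]
      unfolding h_def power_divide arc_sqrt_square by (metis arc_sqrt_square divide_self power_not_zero)
    then show ?thesis by (simp add: power2_eq_1_iff)
  qed
  have "h constant_on {-1..1}"
    by (rule continuous_finite_range_constant[OF _ ch])
      (auto intro: finite_subset[of _ "{1,-1}"] dest: sq)
  moreover have "h 1 = 1"
    using b(1) G(4) by (auto simp: h_def arc_sqrt_def arc_param_def)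
  ultimately have "h x = 1" using x unfolding constant_on_def by fastforce
  then show ?thesis using arc_sqrt_nonzero[OF b(1)] by (simp add: h_def)
qed

lemma airfoil_U_inv_eq:
  assumes b: "b\<^sup>2 \<noteq> 1" "Re b \<noteq> 0" "Im b \<noteq> 0" and S: "airfoil_sqrt_branch b S"
    and x: "x \<in> {-1..1}"
  shows "airfoil_U_inv b S x = arc_param b (of_real x)"
proof -
  have U: "airfoil_U b S (arc_param b (of_real t)) = of_real t" if "t \<in> {-1..1}" for t
    using branch_on_arc[OF b S that] arc_sqrt_nonzero[OF b(1)]
    by (simp add: airfoil_U_def arc_param_def)
  have "inj_on (airfoil_U b S) (airfoil_arc b)"
    unfolding arc_param_image[OF b(1), symmetric] by (auto simp: inj_on_def U)
  moreover have "arc_param b (of_real x) \<in> airfoil_arc b"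
    using arc_param_image[OF b(1)] x by blast
  ultimately show ?thesis
    unfolding airfoil_U_inv_def using U[OF x] by (metis inv_into_f_f)
qed

section \<open>Explicit form and degree of the Faber polynomials\<close>

text \<open>In the variable x = 1/w this is the identity theorem for the power series with coefficients 0, c_0, c_1, \<dots>;
the shift by one makes it vanish at x = 0 too.\<close>

lemma power_series_coefficients_zero:
  fixes c :: "nat \<Rightarrow> complex"
  assumes "\<forall>\<^sub>F w in at_infinity. (\<lambda>n. c n / w ^ (n + 1)) sums 0"
  shows "c n = 0"
proof (rule ccontr)
  assume n: "c n \<noteq> 0"
  define a where "a k = (case k of 0 \<Rightarrow> 0 | Suc m \<Rightarrow> c m)" for k
  obtain M where M: "\<And>w. norm w \<ge> M \<Longrightarrow> (\<lambda>n. c n / w ^ (n + 1)) sums 0"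
    using assms unfolding eventually_at_infinity by blast
  define r where "r = 1 / (\<bar>M\<bar> + 1)"
  have "(\<lambda>k. a k * (x - 0) ^ k) sums 0" if x: "norm (x - 0) < r" for x
  proof (cases "x = 0")
    case True
    have "(\<lambda>k. a k * 0 ^ k) sums 0" by (simp add: a_def)
    then show ?thesis using True by simp
  next
    case False
    have "M \<le> norm (1 / x)"
      using x False unfolding r_def by (simp add: norm_divide field_simps) (smt (verit) mult_nonneg_nonneg norm_ge_zero mult_right_mono)
    from M[OF this] have "(\<lambda>n. a (Suc n) * x ^ (Suc n)) sums 0"
      by (simp add: a_def power_divide)
    then show ?thesis by (subst (asm) sums_Suc_iff) (simp add: a_def)
  qed
  moreover have "r > 0" by (simp add: r_def)
  moreover have "a (Suc n) \<noteq> 0" using n by (simp add: a_def)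
  ultimately obtain s where s: "0 < s" "\<And>z::complex. z \<in> cball 0 s - {0} \<Longrightarrow> (0::complex) \<noteq> 0"
    using powser_0_nonzero[of r 0 a "\<lambda>_. 0" "Suc n"] by blast
  \<comment> \<open>The sum vanishes identically, whereas zeros of a nontrivial power series are isolated.\<close>
  have "of_real s \<in> cball (0::complex) s - {0}" using s(1) by auto
  then show False using s(2) by blast
qed

text \<open>With x = a w + b, the function \<Psi>(w) - z equals (x - b - p) (x - b - q) / (2 x), so its logarithmic
derivative in w is 1/(w - p/a) + 1/(w - q/a) - 1/(w + b/a). Each term is a geometric series in 1/w.\<close>

lemma faber_polynomial_eq:
  assumes R: "1 < R * cos \<theta>" and b: "b = airfoil_b R \<theta>"
    and F: "faber_polynomials K (airfoil_map R \<theta>) F"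
    and pq: "p + q = 2 * (z - b)" "p * q = airfoil_V b z"
  shows "poly (F n) z = (p ^ n + q ^ n - (- b) ^ n) / (1 - b) ^ n"
proof -
  define a where "a = 1 - b"
  have ab: "airfoil_a R \<theta> = a" "airfoil_b R \<theta> = b" and a: "a \<noteq> 0"
    using airfoil_parameters[OF R] b by (auto simp: a_def)
  define \<alpha> \<beta> \<gamma> where d: "\<alpha> = p / a" "\<beta> = q / a" "\<gamma> = - b / a"
  have ev: "\<forall>\<^sub>F w in at_infinity. w \<noteq> \<alpha> \<and> w \<noteq> \<beta> \<and> w \<noteq> \<gamma>"
    by (intro eventually_conj eventually_not_equal_at_infinity)
  have "\<forall>\<^sub>F w in at_infinity. (\<lambda>n. poly (F n) z / w ^ (n + 1)) sums
      (deriv (airfoil_map R \<theta>) w / (airfoil_map R \<theta> w - z))"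
    using F unfolding faber_polynomials_def by blast
  then have "\<forall>\<^sub>F w in at_infinity. (\<lambda>n. (poly (F n) z - (\<alpha> ^ n + \<beta> ^ n - \<gamma> ^ n)) / w ^ (n + 1)) sums 0"
    using geometric_sums_at_infinity[of \<alpha>] geometric_sums_at_infinity[of \<beta>]
      geometric_sums_at_infinity[of \<gamma>] ev
  proof eventually_elim
    case (elim w)
    define x where "x = a * w + b"
    have nz: "x \<noteq> 0" "x - b - p \<noteq> 0" "x - b - q \<noteq> 0"
      using elim(5) a unfolding d x_def by (auto simp: field_simps eq_neg_iff_add_eq_0)
    have "((\<lambda>w. ((a * w + b) + 1 / (a * w + b)) / 2) has_field_derivative
        (a - a / x\<^sup>2) / 2) (at w)"
      using nz unfolding x_def by (auto intro!: derivative_eq_intros simp: power2_eq_square)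
    then have D: "deriv (airfoil_map R \<theta>) w = (a - a / x\<^sup>2) / 2"
      unfolding airfoil_map_def joukowski_def ab by (intro DERIV_imp_deriv)
    have prod: "(x - b - p) * (x - b - q) = x\<^sup>2 - 2 * z * x + 1"
    proof -
      have "(x - b - p) * (x - b - q) = (x - b)\<^sup>2 - (p + q) * (x - b) + p * q"
        by (simp add: power2_eq_square algebra_simps)
      then show ?thesis
        unfolding pq airfoil_V_def by (simp add: power2_eq_square algebra_simps)
    qed
    have M: "airfoil_map R \<theta> w - z = (x - b - p) * (x - b - q) / (2 * x)"
      using nz unfolding prod airfoil_map_def joukowski_def ab x_def[symmetric]
      by (simp add: field_simps power2_eq_square)
    have w: "w - \<alpha> = (x - b - p) / a" "w - \<beta> = (x - b - q) / a" "w - \<gamma> = x / a"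
      using a by (simp_all add: d x_def field_simps)
    define A B where AB: "A = x - b - p" "B = x - b - q"
    have num: "x * (A + B) - A * B = x\<^sup>2 - 1"
    proof -
      have "A + B = 2 * x - 2 * b - (p + q)" by (simp add: AB)
      also have "\<dots> = 2 * x - 2 * z" unfolding pq by simp
      finally show ?thesis
        using prod unfolding AB by (simp add: power2_eq_square algebra_simps)
    qed
    have "1 / (w - \<alpha>) + 1 / (w - \<beta>) - 1 / (w - \<gamma>) = a * (x * (A + B) - A * B) / (x * A * B)"
      using nz a unfolding w AB[symmetric] by (simp add: field_simps)
    also have "\<dots> = deriv (airfoil_map R \<theta>) w / (airfoil_map R \<theta> w - z)"
      using nz unfolding num D M AB[symmetric] by (simp add: field_simps power2_eq_square)
    finally have "(\<lambda>n. poly (F n) z / w ^ (n + 1) - (\<alpha> ^ n / w ^ (n + 1) + \<beta> ^ n / w ^ (n + 1)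
        - \<gamma> ^ n / w ^ (n + 1))) sums (deriv (airfoil_map R \<theta>) w / (airfoil_map R \<theta> w - z)
        - deriv (airfoil_map R \<theta>) w / (airfoil_map R \<theta> w - z))"
      using sums_diff[OF elim(1) sums_diff[OF sums_add[OF elim(2,3)] elim(4)]] by metis
    then show ?case by (simp add: diff_divide_distrib add_divide_distrib)
  qed
  then have "poly (F n) z - (\<alpha> ^ n + \<beta> ^ n - \<gamma> ^ n) = 0"
    by (rule power_series_coefficients_zero)
  then show ?thesis
    unfolding d power_divide a_def by (simp add: add_divide_distrib diff_divide_distrib)
qed

text \<open>Power sums of p and q satisfy the recursion
p^(n+2) + q^(n+2) = (p + q) (p^(n+1) + q^(n+1)) - p q (p^n + q^n), whose coefficients are polynomials
in z of degree 1. The top coefficient therefore comes from the first product alone.\<close>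

lemma power_sum_polynomial:
  "\<exists>G. degree G \<le> n \<and> (n \<ge> 1 \<longrightarrow> coeff G n = 2 ^ n) \<and>
    (\<forall>p q z. p + q = 2 * (z - b) \<longrightarrow> p * q = airfoil_V b z \<longrightarrow> poly G z = p ^ n + q ^ n)"
proof (induction n rule: less_induct)
  case (less n)
  consider "n = 0" | "n = 1" | m where "n = Suc (Suc m)"
    by (metis One_nat_def not0_implies_Suc)
  then show ?case
  proof cases
    case 1
    then show ?thesis by (intro exI[of _ "[:2:]"]) simp
  next
    case 2
    then show ?thesis by (intro exI[of _ "[:-2 * b, 2:]"]) (simp add: algebra_simps)
  next
    case (3 m)
    obtain G H where
      G: "degree G \<le> m" "\<And>p q z. p + q = 2 * (z - b) \<Longrightarrow> p * q = airfoil_V b z \<Longrightarrow> poly G z = p ^ m + q ^ m"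
      and H: "degree H \<le> Suc m" "coeff H (Suc m) = 2 ^ Suc m"
        "\<And>p q z. p + q = 2 * (z - b) \<Longrightarrow> p * q = airfoil_V b z \<Longrightarrow> poly H z = p ^ Suc m + q ^ Suc m"
      using less[of m] less[of "Suc m"] 3 by force
    define I where "I = [:- 2 * b, 2:] * H - [:b\<^sup>2 + 1, - 2 * b:] * G"
    have "coeff H (Suc (Suc m)) = 0" "coeff G (Suc m) = 0" "coeff G (Suc (Suc m)) = 0"
      using G(1) H(1) by (auto intro: coeff_eq_0)
    then have "coeff I n = 2 ^ n"
      using H(2) by (simp add: I_def 3)
    moreover have "degree I \<le> n"
    proof -
      have "degree ([:- 2 * b, 2:] * H) \<le> n" "degree ([:b\<^sup>2 + 1, - 2 * b:] * G) \<le> n"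
        using degree_mult_le[of "[:- 2 * b, 2:]" H] degree_mult_le[of "[:b\<^sup>2 + 1, - 2 * b:]" G]
          H(1) G(1) 3 by (auto split: if_splits)
      then show ?thesis unfolding I_def by (rule degree_diff_le)
    qed
    moreover have "poly I z = p ^ n + q ^ n"
      if "p + q = 2 * (z - b)" "p * q = airfoil_V b z" for p q z
    proof -
      have 1: "poly [:- 2 * b, 2:] z = p + q" using that(1) by simp
      have 2: "poly [:b\<^sup>2 + 1, - 2 * b:] z = p * q" using that(2) by (simp add: airfoil_V_def)
      show ?thesis
        unfolding I_def poly_diff poly_mult 1 2 G(2)[OF that] H(3)[OF that] 3
        by (simp add: algebra_simps)
    qed
    ultimately show ?thesis by blast
  qed
qed

lemma sum_and_product_exist:
  obtains p q :: complex where "p + q = 2 * (z - b)" "p * q = airfoil_V b z"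
proof
  define r where "r = csqrt ((z - b)\<^sup>2 - airfoil_V b z)"
  show "(z - b + r) + (z - b - r) = 2 * (z - b)" by simp
  have "(z - b + r) * (z - b - r) = (z - b)\<^sup>2 - r\<^sup>2" by (simp add: power2_eq_square algebra_simps)
  then show "(z - b + r) * (z - b - r) = airfoil_V b z" by (simp add: r_def)
qed

lemma degree_faber_polynomial:
  assumes R: "1 < R * cos \<theta>"
    and F: "faber_polynomials K (airfoil_map R \<theta>) F" and n: "n \<ge> 1"
  shows "degree (F n) = n"
proof -
  define b where "b = airfoil_b R \<theta>"
  obtain G where G: "degree G \<le> n" "coeff G n = 2 ^ n"
    "\<And>p q z. p + q = 2 * (z - b) \<Longrightarrow> p * q = airfoil_V b z \<Longrightarrow> poly G z = p ^ n + q ^ n"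
    using power_sum_polynomial[of n b] n by blast
  have a: "1 - b \<noteq> 0" using airfoil_parameters[OF R] by (auto simp: b_def)
  have "poly (F n) z = poly (smult (1 / (1 - b) ^ n) (G - [:(- b) ^ n:])) z" for z
  proof -
    obtain p q where pq: "p + q = 2 * (z - b)" "p * q = airfoil_V b z"
      by (rule sum_and_product_exist)
    show ?thesis
      using faber_polynomial_eq[OF R b_def F pq] G(3)[OF pq] by simp
  qed
  then have F: "F n = smult (1 / (1 - b) ^ n) (G - [:(- b) ^ n:])"
    by (simp add: poly_eq_poly_eq_iff[symmetric] ext)
  have "degree (F n) \<le> n"
    unfolding F using G(1) by (simp add: degree_diff_le)
  moreover have "coeff (F n) n \<noteq> 0"
  proof -
    have "coeff [:(- b) ^ n:] n = 0" using n by (cases n) simp_all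
    then show ?thesis using a G(2) unfolding F by simp
  qed
  ultimately show ?thesis by (simp add: le_antisym le_degree)
qed

lemma faber_polynomial_on_arc:
  assumes R: "1 < R * cos \<theta>" and b: "b = airfoil_b R \<theta>"
    and F: "faber_polynomials K (airfoil_map R \<theta>) F"
  shows "poly (F n) (arc_param b (cos w)) =
    (2 * arc_sqrt b (cos w) ^ n * cos (of_nat n * w) - (- b) ^ n) / (1 - b) ^ n"
proof -
  define s where "s = arc_sqrt b (cos w)"
  have e: "exp (\<i> * v) + exp (- (\<i> * v)) = 2 * cos v" for v by (simp add: cos_exp_eq)
  have 1: "s * exp (\<i> * w) + s * exp (- (\<i> * w)) = 2 * (arc_param b (cos w) - b)"
    unfolding distrib_left[symmetric] e by (simp add: arc_param_def s_def)
  have 2: "s * exp (\<i> * w) * (s * exp (- (\<i> * w))) = airfoil_V b (arc_param b (cos w))"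
    unfolding arc_sqrt_square[symmetric] s_def[symmetric]
    by (simp add: power2_eq_square exp_minus)
  have "(s * exp (\<i> * w)) ^ n + (s * exp (- (\<i> * w))) ^ n
      = s ^ n * (exp (\<i> * (of_nat n * w)) + exp (- (\<i> * (of_nat n * w))))"
    by (simp add: power_mult_distrib exp_of_nat_mult[symmetric] algebra_simps)
  also have "\<dots> = 2 * s ^ n * cos (of_nat n * w)" unfolding e by simp
  finally have "(s * exp (\<i> * w)) ^ n + (s * exp (- (\<i> * w))) ^ n = 2 * s ^ n * cos (of_nat n * w)" .
  then show ?thesis using faber_polynomial_eq[OF R b F 1 2, of n] by (simp add: s_def)
qed

section \<open>No zeros away from the arc\<close>

text \<open>Put u = p + b = s + i t; then q + b = 1/u. The two inequalities become
|u|^2 \<le> 2 (s Re b + t Im b) and 1 \<le> 2 (s Re b - t Im b). Their sum 1 + |u|^2 \<le> 4 s Re b \<le> 2 |s| leaves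
only u = 1 and u = -1, where u = 1/u. This is the place where the bound on Re b enters.\<close>

lemma roots_equal_if_le_norm_b:
  assumes b: "\<bar>Re b\<bar> \<le> 1 / 2"
    and pq: "p + q = 2 * (z - b)" "p * q = airfoil_V b z"
    and small: "norm p \<le> norm b" "norm q \<le> norm b"
  shows "p = q"
proof -
  define u v where uv: "u = p + b" "v = q + b"
  have prod: "u * v = 1"
  proof -
    have "u * v = p * q + b * (p + q) + b\<^sup>2" by (simp add: uv power2_eq_square algebra_simps)
    then show ?thesis unfolding pq airfoil_V_def by (simp add: power2_eq_square algebra_simps)
  qed
  define s t where st: "s = Re u" "t = Im u"
  define r where "r = s\<^sup>2 + t\<^sup>2"
  have "u \<noteq> 0" using prod by auto
  then have r: "r > 0" unfolding r_def st by (simp add: complex_eq_iff sum_power2_gt_zero_iff)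
  have "v = 1 / u" using prod \<open>u \<noteq> 0\<close> by (simp add: field_simps)
  then have v: "Re v = s / r" "Im v = - t / r"
    by (simp_all add: Re_divide Im_divide st r_def)
  have *: "(Re w)\<^sup>2 + (Im w)\<^sup>2 \<le> 2 * (Re w * Re b + Im w * Im b)"
    if "norm (w - b) \<le> norm b" for w
  proof -
    have "(norm (w - b))\<^sup>2 \<le> (norm b)\<^sup>2" using that by (intro power_mono) auto
    then show ?thesis unfolding cmod_power2 by (simp add: power2_eq_square algebra_simps)
  qed
  have 1: "r \<le> 2 * (s * Re b + t * Im b)"
    using *[of u] small by (simp add: uv st r_def)
  have "(s / r)\<^sup>2 + (- t / r)\<^sup>2 \<le> 2 * (s / r * Re b + - t / r * Im b)"
    using *[of v] small unfolding v by (simp add: uv)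
  moreover have "(s / r)\<^sup>2 + (- t / r)\<^sup>2 = 1 / r"
  proof -
    have "(s / r)\<^sup>2 + (- t / r)\<^sup>2 = (s\<^sup>2 + t\<^sup>2) / r\<^sup>2" by (simp add: power_divide add_divide_distrib)
    then show ?thesis using r unfolding r_def[symmetric] by (simp add: power2_eq_square)
  qed
  ultimately have "1 / r \<le> 2 * (s * Re b - t * Im b) / r"
    by (simp add: diff_divide_distrib right_diff_distrib)
  then have 2: "1 \<le> 2 * (s * Re b - t * Im b)" using r by (simp add: divide_le_cancel)
  have "2 * (s * Re b) \<le> \<bar>s\<bar>"
    using b mult_left_mono[OF b, of "\<bar>s\<bar>"] abs_ge_self[of "s * Re b"] by (simp add: abs_mult)
  then have "1 + r \<le> 2 * \<bar>s\<bar>" using 1 2 by (simp add: algebra_simps)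
  then have "(\<bar>s\<bar> - 1)\<^sup>2 + t\<^sup>2 \<le> 0" unfolding r_def by (simp add: power2_eq_square algebra_simps)
  then have "\<bar>s\<bar> = 1" "t = 0" by (simp_all add: sum_power2_le_zero_iff)
  then have "u * u = 1"
    unfolding st by (auto simp: complex_eq_iff abs_if power2_eq_square split: if_splits)
  then have "u * u = u * v" using prod by simp
  then show ?thesis using \<open>u \<noteq> 0\<close> by (simp add: uv)
qed

text \<open>If |p| = |q| and s^2 = p q, then p/s and q/s are unimodular and inverse to each other, hence
conjugate, and U(z) = (p/s + q/s)/2 is the real part of p/s.\<close>

lemma in_arc_if_equal_modulus:
  assumes b: "b\<^sup>2 \<noteq> 1"
    and pq: "p + q = 2 * (z - b)" "p * q = airfoil_V b z" "norm p = norm q"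
  shows "z \<in> airfoil_arc b"
proof -
  have p: "p \<noteq> 0"
  proof
    assume "p = 0"
    then have "z = b" "airfoil_V b z = 0" using pq by auto
    then show False using b by (simp add: airfoil_V_def power2_eq_square)
  qed
  define s where "s = csqrt (p * q)"
  have s: "s\<^sup>2 = p * q" by (simp add: s_def)
  have q: "q \<noteq> 0" using p pq(3) by auto
  have s0: "s \<noteq> 0" using s p q by auto
  have "(norm s)\<^sup>2 = (norm p)\<^sup>2"
    using arg_cong[OF s, of norm] pq(3) by (simp add: norm_power norm_mult power2_eq_square)
  then have n: "norm (p / s) = 1" using p by (simp add: norm_divide)
  have "(p / s) * (q / s) = 1" using s s0 p q by (simp add: power2_eq_square)
  then have "q / s = cnj (p / s)"
    using n complex_norm_square[of "p / s"] p s0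
    by (metis mult_cancel_left divide_eq_0_iff one_power2 of_real_1)
  then have "p / s + q / s = of_real (2 * Re (p / s))" by (simp only: complex_add_cnj)
  then have "2 * ((z - b) / s) = 2 * of_real (Re (p / s))"
    using pq(1) by (simp add: add_divide_distrib[symmetric])
  then have "(z - b) / s = of_real (Re (p / s))" by (simp only: mult_cancel_left) simp
  moreover have "Re (p / s) \<in> {-1..1}"
    using abs_Re_le_cmod[of "p / s"] n by (simp add: abs_le_iff)
  ultimately show ?thesis
    using s s0 pq(2) unfolding airfoil_arc_def by (metis (mono_tags, lifting) image_eqI mem_Collect_eq)
qed

text \<open>For x = cos t the numbers p and q are s e^(it) and s e^(-it), both of modulus |s|. They are different
when x is neither 1 nor -1, so they cannot both be at most |b| in modulus, by
\<open>roots_equal_if_le_norm_b\<close>.\<close>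

lemma norm_arc_sqrt_gt:
  assumes b: "\<bar>Re b\<bar> \<le> 1 / 2" "b\<^sup>2 \<noteq> 1" and x: "- 1 < x" "x < 1"
  shows "norm b < norm (arc_sqrt b (of_real x))"
proof (rule ccontr)
  assume n: "\<not> ?thesis"
  define s y where "s = arc_sqrt b (of_real x)" and "y = sqrt (1 - x\<^sup>2)"
  have "x\<^sup>2 < 1" using x by (simp add: abs_square_less_1 abs_less_iff)
  then have y: "y > 0" "y * y = 1 - x * x" by (auto simp: y_def power2_eq_square[symmetric])
  have nrm: "norm (Complex x y) = 1" "norm (Complex x (- y)) = 1"
    using y by (simp_all add: cmod_def power2_eq_square)
  have 1: "s * Complex x y + s * Complex x (- y) = 2 * (arc_param b (of_real x) - b)"
    by (simp add: arc_param_def s_def[symmetric] complex_eq_iff algebra_simps)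
  have "Complex x y * Complex x (- y) = 1" using y by (simp add: complex_eq_iff algebra_simps)
  then have 2: "s * Complex x y * (s * Complex x (- y)) = airfoil_V b (arc_param b (of_real x))"
    unfolding arc_sqrt_square[symmetric] s_def[symmetric] power2_eq_square
    by (metis mult.assoc mult.left_commute mult.right_neutral)
  have "s * Complex x y = s * Complex x (- y)"
    using n by (intro roots_equal_if_le_norm_b[OF b(1) 1 2]) (simp_all add: norm_mult nrm s_def)
  then show False using arc_sqrt_nonzero[OF b(2)] y(1) by (simp add: s_def)
qed

text \<open>By symmetry one may take z = J(u), p = u - b with |u| \<ge> 1. For bounded u the quotient of the two
sides is a continuous function on a compact set and is less than 1 there: off the arc
|p| and |q| differ (\<open>in_arc_if_equal_modulus\<close>), so the larger one exceeds |b|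
(\<open>roots_equal_if_le_norm_b\<close>). For large u the number p grows while 1/u - b and b stay bounded.\<close>

lemma uniform_domination:
  assumes b: "\<bar>Re b\<bar> \<le> 1 / 2" "b\<^sup>2 \<noteq> 1" and N: "open N" "airfoil_arc b \<subseteq> N"
  obtains \<rho> where "0 \<le> \<rho>" "\<rho> < 1"
    "\<And>p q z. p + q = 2 * (z - b) \<Longrightarrow> p * q = airfoil_V b z \<Longrightarrow> z \<notin> N \<Longrightarrow>
      max (min (norm p) (norm q)) (norm b) \<le> \<rho> * max (norm p) (norm q)"
proof -
  define h where "h u = max (min (norm (u - b)) (norm (1 / u - b))) (norm b)
      / max (norm (u - b)) (norm (1 / u - b))" for u
  \<comment> \<open>This L makes |u| - |b| \<ge> 2 (1 + |b|) for |u| \<ge> L.\<close>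
  define L where "L = 2 + 3 * norm b"
  define J where "J = {u. norm u \<ge> 1} \<inter> joukowski -` (- N)"
  define K where "K = J \<inter> cball 0 L"
  have less: "max (min (norm (u - b)) (norm (1 / u - b))) (norm b)
      < max (norm (u - b)) (norm (1 / u - b))" if "u \<in> J" for u
  proof -
    have u: "u \<noteq> 0" "joukowski u \<notin> N" using that by (auto simp: J_def)
    have pq: "(u - b) + (1 / u - b) = 2 * (joukowski u - b)"
      "(u - b) * (1 / u - b) = airfoil_V b (joukowski u)"
      using u(1) by (simp_all add: joukowski_def airfoil_V_def field_simps power2_eq_square)
    have ne: "norm (u - b) \<noteq> norm (1 / u - b)"
      using in_arc_if_equal_modulus[OF b(2) pq] u(2) N(2) by blast
    then have "\<not> (norm (u - b) \<le> norm b \<and> norm (1 / u - b) \<le> norm b)"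
      using roots_equal_if_le_norm_b[OF b(1) pq] by auto
    then show ?thesis using ne by (auto simp: max_def min_def)
  qed
  have pos: "0 < max (norm (u - b)) (norm (1 / u - b))" if "u \<in> J" for u
    using less[OF that] norm_ge_zero[of b] by linarith
  have "closed J"
    unfolding J_def joukowski_def using N(1)
    by (intro continuous_closed_preimage continuous_intros closed_Collect_le) auto
  then have K: "compact K" unfolding K_def by (simp add: closed_Int_compact)
  have contK: "continuous_on K h"
  proof -
    have "u \<noteq> 0" if "u \<in> K" for u using that by (auto simp: K_def J_def)
    moreover have "max (norm (u - b)) (norm (1 / u - b)) \<noteq> 0" if "u \<in> K" for u
      using pos[of u] that by (auto simp: K_def)
    ultimately show ?thesis unfolding h_def by (intro continuous_intros) auto
  qed
  obtain \<rho>0 where \<rho>0: "\<rho>0 < 1" "\<And>u. u \<in> K \<Longrightarrow> h u \<le> \<rho>0"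
  proof (cases "K = {}")
    case True
    then show ?thesis using that[of 0] by auto
  next
    case False
    then obtain u where "u \<in> K" "\<forall>v\<in>K. h v \<le> h u"
      using continuous_attains_sup[OF K _ contK] by blast
    moreover have "h u < 1"
      using less[of u] pos[of u] \<open>u \<in> K\<close> by (simp add: h_def K_def divide_less_eq_1)
    ultimately show ?thesis using that by blast
  qed
  define \<rho> where "\<rho> = max \<rho>0 (1 / 2)"
  have bound: "h u \<le> \<rho>" if u: "u \<in> J" for u
  proof (cases "norm u \<le> L")
    case True
    then show ?thesis using \<rho>0(2)[of u] u by (simp add: K_def \<rho>_def)
  next
    case False
    have "norm u - norm b \<le> norm (u - b)" by (rule norm_triangle_ineq2)
    moreover have "norm (1 / u - b) \<le> 1 + norm b"
    proof -
      have "norm (1 / u) \<le> 1" using u by (simp add: J_def norm_divide divide_le_eq_1)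
      then show ?thesis using norm_triangle_ineq4[of "1 / u" b] by linarith
    qed
    ultimately have "2 * max (min (norm (u - b)) (norm (1 / u - b))) (norm b)
        \<le> max (norm (u - b)) (norm (1 / u - b))"
      using False norm_ge_zero[of b] unfolding L_def by linarith
    then have "h u \<le> 1 / 2" using pos[OF u] by (simp add: h_def pos_divide_le_eq)
    then show ?thesis by (simp add: \<rho>_def)
  qed
  show thesis
  proof
    show "0 \<le> \<rho>" "\<rho> < 1" using \<rho>0(1) by (auto simp: \<rho>_def)
    \<comment> \<open>One of the reciprocal numbers p + b and q + b has modulus at least 1.\<close>
    fix p q z assume pq: "p + q = 2 * (z - b)" "p * q = airfoil_V b z" and z: "z \<notin> N"
    have main: "max (min (norm p) (norm q)) (norm b) \<le> \<rho> * max (norm p) (norm q)"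
      if pq: "p + q = 2 * (z - b)" "p * q = airfoil_V b z" and u1: "norm (p + b) \<ge> 1" for p q
    proof -
      define u where "u = p + b"
      have u0: "u \<noteq> 0" using u1 by (auto simp: u_def)
      have "u * (q + b) = p * q + b * (p + q) + b\<^sup>2"
        by (simp add: u_def power2_eq_square algebra_simps)
      also have "\<dots> = 1" unfolding pq airfoil_V_def by (simp add: power2_eq_square algebra_simps)
      finally have q: "q = 1 / u - b" using u0 by (simp add: field_simps)
      have p: "p = u - b" by (simp add: u_def)
      have "joukowski u = z" using pq(1) unfolding p q joukowski_def by (simp add: field_simps)
      then have "u \<in> J" using z u1 by (simp add: J_def u_def)
      from bound[OF this] pos[OF this] show ?thesis
        unfolding h_def p q by (simp add: pos_divide_le_eq)
    qed
    have "(p + b) * (q + b) = p * q + b * (p + q) + b\<^sup>2"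
      by (simp add: power2_eq_square algebra_simps)
    also have "\<dots> = 1" unfolding pq airfoil_V_def by (simp add: power2_eq_square algebra_simps)
    finally have "norm (p + b) * norm (q + b) = 1" by (metis norm_mult norm_one)
    then have "norm (p + b) \<ge> 1 \<or> norm (q + b) \<ge> 1"
      using mult_strict_mono[of "norm (p + b)" 1 "norm (q + b)" 1]
      by (cases "norm (p + b) < 1"; cases "norm (q + b) < 1") auto
    then show "max (min (norm p) (norm q)) (norm b) \<le> \<rho> * max (norm p) (norm q)"
    proof
      assume "1 \<le> norm (q + b)"
      moreover have "q + p = 2 * (z - b)" "q * p = airfoil_V b z" using pq by (simp_all add: ac_simps)
      ultimately have "max (min (norm q) (norm p)) (norm b) \<le> \<rho> * max (norm q) (norm p)"
        by (intro main)
      then show ?thesis by (simp only: max.commute[of "norm q"] min.commute[of "norm q"])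
    qed (rule main[OF pq])
  qed
qed

lemma faber_zeros_near_arc:
  assumes R: "1 < R * cos \<theta>" "R * cos \<theta> \<le> 3 / 2" and b: "b = airfoil_b R \<theta>" "b\<^sup>2 \<noteq> 1"
    and F: "faber_polynomials K (airfoil_map R \<theta>) F"
    and N: "open N" "airfoil_arc b \<subseteq> N"
  shows "\<forall>\<^sub>F n in sequentially. \<forall>z. poly (F n) z = 0 \<longrightarrow> z \<in> N"
proof -
  have Re: "Re b = 1 - R * cos \<theta>"
    unfolding b(1) airfoil_b_def by (simp flip: cis_conv_exp)
  have "\<bar>Re b\<bar> \<le> 1 / 2" using R unfolding Re by simp
  then obtain \<rho> where \<rho>: "0 \<le> \<rho>" "\<rho> < 1"
    "\<And>p q z. p + q = 2 * (z - b) \<Longrightarrow> p * q = airfoil_V b z \<Longrightarrow> z \<notin> N \<Longrightarrow>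
      max (min (norm p) (norm q)) (norm b) \<le> \<rho> * max (norm p) (norm q)"
    using uniform_domination[OF _ b(2) N] by blast
  have a: "1 - b \<noteq> 0" using b(2) by auto
  have b0: "norm b > 0" using R unfolding zero_less_norm_iff by (auto simp: complex_eq_iff Re)
  have "(\<lambda>n. \<rho> ^ n) \<longlonglongrightarrow> 0" using \<rho> by (intro LIMSEQ_realpow_zero) auto
  then have "\<forall>\<^sub>F n in sequentially. \<rho> ^ n < 1 / 2" by (rule order_tendstoD) simp
  then show ?thesis
  proof eventually_elim
    case (elim n)
    show ?case
    proof (intro allI impI, rule ccontr)
      fix z assume z: "poly (F n) z = 0" "z \<notin> N"
      obtain p q where pq: "p + q = 2 * (z - b)" "p * q = airfoil_V b z"
        by (rule sum_and_product_exist)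
      have main: False
        if pq: "p + q = 2 * (z - b)" "p * q = airfoil_V b z" and le: "norm q \<le> norm p" for p q
      proof -
        have le: "norm q \<le> \<rho> * norm p" "norm b \<le> \<rho> * norm p"
          using \<rho>(3)[OF pq z(2)] le by (auto simp: max_def min_def split: if_splits)
        have "p ^ n + q ^ n - (- b) ^ n = 0"
          using faber_polynomial_eq[OF R(1) b(1) F pq, of n] z(1) a by simp
        then have "p ^ n = (- b) ^ n - q ^ n" by (simp add: algebra_simps)
        then have "norm p ^ n = norm ((- b) ^ n - q ^ n)" by (metis norm_power)
        also have "\<dots> \<le> norm b ^ n + norm q ^ n"
          using norm_triangle_ineq4[of "(- b) ^ n" "q ^ n"] by (simp add: norm_power)
        also have "\<dots> \<le> (\<rho> * norm p) ^ n + (\<rho> * norm p) ^ n"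
          using le by (intro add_mono power_mono) auto
        also have "\<dots> = 2 * \<rho> ^ n * norm p ^ n" by (simp add: power_mult_distrib)
        also have "\<dots> < 1 * norm p ^ n"
        proof (rule mult_strict_right_mono)
          have "norm p > 0"
            using le(2) b0 by (cases "p = 0") auto
          then show "norm p ^ n > 0" by simp
        qed (use elim in simp)
        finally show False by simp
      qed
      have "q + p = 2 * (z - b)" "q * p = airfoil_V b z" using pq by (simp_all add: ac_simps)
      then show False using main[OF pq] main[of q p] by linarith
    qed
  qed
qed

section \<open>Zeros close to equidistributed nodes\<close>

text \<open>Uniform continuity on a compact set K, but with only one of the two points required to lie in K.\<close>

lemma uniformly_close_to_compact:
  fixes h :: "'a::euclidean_space \<Rightarrow> 'b::metric_space"
  assumes K: "compact K" "K \<subseteq> U" and U: "open U" and h: "continuous_on U h" and e: "e > 0"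
  obtains d where "d > 0" "\<And>x y. x \<in> K \<Longrightarrow> dist x y < d \<Longrightarrow> y \<in> U \<and> dist (h x) (h y) < e"
proof -
  obtain r where r: "r > 0" "(\<Union>x\<in>K. ball x r) \<subseteq> U"
    using compact_subset_open_imp_ball_epsilon_subset[OF K(1) U K(2)] by blast
  define T where "T = {x + y | x y. x \<in> K \<and> y \<in> cball 0 (r / 2)}"
  have T: "x \<in> K \<Longrightarrow> dist x y \<le> r / 2 \<Longrightarrow> y \<in> T" for x y :: 'a
  proof -
    assume "x \<in> K" "dist x y \<le> r / 2"
    moreover from this have "y - x \<in> cball 0 (r / 2)" by (simp add: dist_norm norm_minus_commute)
    moreover have "y = x + (y - x)" by simp
    ultimately show "y \<in> T" unfolding T_def by blast
  qed
  have TU: "T \<subseteq> U"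
  proof
    fix y assume "y \<in> T"
    then obtain x v where "x \<in> K" "y = x + v" "norm v \<le> r / 2" by (auto simp: T_def)
    then have "y \<in> ball x r" using r(1) by (simp add: dist_norm)
    then show "y \<in> U" using r(2) \<open>x \<in> K\<close> by blast
  qed
  have "compact T" unfolding T_def by (intro compact_sums K compact_cball)
  then have "uniformly_continuous_on T h"
    by (rule compact_uniformly_continuous[OF continuous_on_subset[OF h TU]])
  then obtain d where d: "d > 0" "\<And>x y. x \<in> T \<Longrightarrow> y \<in> T \<Longrightarrow> dist y x < d \<Longrightarrow> dist (h y) (h x) < e"
    using e unfolding uniformly_continuous_on_def by meson
  show thesis
  proof
    show "min d (r / 2) > 0" using d r by simp
    fix x y assume xy: "x \<in> K" "dist x y < min d (r / 2)"
    have "x \<in> T" "y \<in> T" using T[OF xy(1), of x] T[OF xy(1), of y] xy(2) r(1) by auto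
    then show "y \<in> U \<and> dist (h x) (h y) < e" using d(2)[of y x] TU xy(2) by auto
  qed
qed

lemma sin_bounded_below_on_circle:
  obtains m where "m > 0" "\<And>v::complex. norm v = 1 \<Longrightarrow> m \<le> norm (sin v)"
proof -
  have nz: "sin v \<noteq> 0" if "norm v = 1" for v :: complex
  proof
    assume "sin v = 0"
    then obtain k :: int where k: "v = of_real (of_int k * pi)" by (auto simp: sin_eq_0)
    then have "\<bar>of_int k\<bar> * pi = 1" using that by (simp add: norm_mult)
    moreover from this have "k \<noteq> 0" by auto
    then have "1 * pi \<le> \<bar>of_int k\<bar> * pi" by (intro mult_right_mono) (simp_all flip: of_int_abs)
    ultimately show False using pi_gt3 by linarith
  qed
  have "continuous_on (sphere (0::complex) 1) (\<lambda>v. norm (sin v))" by (intro continuous_intros)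
  then obtain u :: complex where u: "u \<in> sphere 0 1" "\<forall>v\<in>sphere (0::complex) 1. norm (sin u) \<le> norm (sin v)"
    using continuous_attains_inf[of "sphere (0::complex) 1" "\<lambda>v. norm (sin v)"] by auto
  show thesis by (rule that[of "norm (sin u)"]) (use u nz in auto)
qed

text \<open>The midpoint of the k-th of n equal parts of the unit interval; \<pi> times it is a zero of cos(n w).\<close>

definition node :: "nat \<Rightarrow> nat \<Rightarrow> real" where
  "node n k = (real k + 1 / 2) / real n"

text \<open>On the circle of radius 1/n about a node c one has n w = n c + v with |v| = 1, so |cos(n w)| = |sin v|
is bounded below independently of n and the node, whereas the perturbation (-b/s)^n tends to zero
exponentially. At the centre the cosine vanishes, so the modulus of the sum is smaller
there than on the circle, and the minimum modulus principle provides a zero.\<close>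

lemma faber_zeros_near_nodes:
  assumes R: "1 < R * cos \<theta>" and b: "b = airfoil_b R \<theta>"
    and b': "\<bar>Re b\<bar> \<le> 1 / 2" "b\<^sup>2 \<noteq> 1" "Re b \<noteq> 0" "Im b \<noteq> 0"
    and F: "faber_polynomials K (airfoil_map R \<theta>) F" and \<eta>: "\<eta> > 0"
  shows "\<forall>\<^sub>F n in sequentially. \<forall>k. \<eta> \<le> node n k \<longrightarrow> node n k \<le> 1 - \<eta> \<longrightarrow>
    (\<exists>w \<in> ball (of_real (pi * node n k)) (1 / real n).
      cos w \<in> arc_domain b \<and> poly (F n) (arc_param b (cos w)) = 0)"
proof (cases "\<eta> \<le> 1 - \<eta>")
  case False
  then show ?thesis by auto
next
  case True
  define U where "U = {w. cos w \<in> arc_domain b}"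
  define h where "h w = norm b / norm (arc_sqrt b (cos w))" for w
  define C where "C = (\<lambda>t. complex_of_real (pi * t)) ` {\<eta>..1 - \<eta>}"
  have s0: "arc_sqrt b x \<noteq> 0" for x by (rule arc_sqrt_nonzero[OF b'(2)])
  have a: "1 - b \<noteq> 0" using b'(2) by auto
  have C: "compact C" "C \<noteq> {}"
    unfolding C_def using True by (auto intro!: compact_continuous_image continuous_intros)
  have CU: "C \<subseteq> U"
  proof
    fix w assume "w \<in> C"
    then obtain t where "w = of_real (pi * t)" by (auto simp: C_def)
    then have "cos w = of_real (cos (pi * t))" by (simp only: cos_of_real)
    then show "w \<in> U"
      using segment_in_arc_domain[OF b'(3,4), of "cos (pi * t)"] by (simp add: U_def)
  qed
  have hU: "continuous_on U h" unfolding h_def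
    using s0 continuous_on_arc_functions(2)[of b] by (intro continuous_intros) (auto simp: U_def)
  obtain w0 where w0: "w0 \<in> C" "\<And>w. w \<in> C \<Longrightarrow> h w \<le> h w0"
    using continuous_attains_sup[OF C continuous_on_subset[OF hU CU]] by blast
  have "h w0 < 1"
  proof -
    obtain t where t: "\<eta> \<le> t" "t \<le> 1 - \<eta>" "w0 = of_real (pi * t)" using w0(1) by (auto simp: C_def)
    have "0 < pi * t" "pi * t < pi" using t \<eta> mult_strict_left_mono[of t 1 pi] by auto
    then have "cos (pi * t) < 1" "-1 < cos (pi * t)"
      using cos_monotone_0_pi[of 0 "pi * t"] cos_monotone_0_pi[of "pi * t" pi] by auto
    then have "norm b < norm (arc_sqrt b (cos w0))"
      using norm_arc_sqrt_gt[OF b'(1,2)] t(3) by (simp add: cos_of_real del: of_real_mult)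
    then show ?thesis using s0 by (simp add: h_def)
  qed
  \<comment> \<open>Any number strictly between the maximum of |b/s| on the compact set and 1 serves as rate.\<close>
  define \<kappa> where "\<kappa> = (1 + h w0) / 2"
  have \<kappa>: "h w0 < \<kappa>" "\<kappa> < 1" using \<open>h w0 < 1\<close> by (auto simp: \<kappa>_def)
  have "0 \<le> h w0" by (simp add: h_def)
  with \<kappa> have \<kappa>0: "0 \<le> \<kappa>" by linarith
  obtain d where d: "d > 0" "\<And>x y. x \<in> C \<Longrightarrow> dist x y < d \<Longrightarrow> y \<in> U \<and> dist (h x) (h y) < \<kappa> - h w0"
    using uniformly_close_to_compact[OF C(1) CU continuous_on_arc_functions(3)[of b, folded U_def] hU, of "\<kappa> - h w0"] \<kappa>
    by auto
  have near: "y \<in> U" "h y < \<kappa>" if "x \<in> C" "dist x y < d" for x y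
    using d(2)[OF that] w0(2)[OF that(1)] by (auto simp: dist_real_def)
  obtain m where m: "m > 0" "\<And>v::complex. norm v = 1 \<Longrightarrow> m \<le> norm (sin v)"
    by (rule sin_bounded_below_on_circle) blast
  have "(\<lambda>n. \<kappa> ^ n) \<longlonglongrightarrow> 0" using \<kappa> \<kappa>0 by (intro LIMSEQ_realpow_zero) auto
  then have ev1: "\<forall>\<^sub>F n in sequentially. \<kappa> ^ n < m" using m(1) by (rule order_tendstoD)
  have ev2: "\<forall>\<^sub>F n in sequentially. 1 / real n < d"
    using order_tendstoD(2)[OF lim_1_over_n[where 'a = real], of d] d(1) by simp
  from ev1 ev2 eventually_gt_at_top[of 0] show ?thesis
  proof eventually_elim
    case (elim n)
    show ?case
    proof (intro allI impI)
      fix k assume k: "\<eta> \<le> node n k" "node n k \<le> 1 - \<eta>"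
      define c where "c = complex_of_real (pi * node n k)"
      define H where "H w = 2 * cos (of_nat n * w) - (- b / arc_sqrt b (cos w)) ^ n" for w
      have cC: "c \<in> C" using k unfolding C_def c_def by (intro image_eqI[of _ _ "node n k"]) auto
      have sub: "cball c (1 / n) \<subseteq> U" and small: "\<And>w. w \<in> cball c (1 / n) \<Longrightarrow> h w < \<kappa>"
        using near[OF cC] elim(2) by (auto simp: subset_iff)
      have hol: "H holomorphic_on U" unfolding H_def U_def
        by (intro holomorphic_intros holomorphic_on_compose_gen[OF _ holomorphic_on_arc_sqrt, unfolded o_def])
          (use s0 in auto)
      have pert: "norm ((- b / arc_sqrt b (cos w)) ^ n) \<le> \<kappa> ^ n" if "w \<in> cball c (1 / n)" for w
      proof -
        have "h w ^ n \<le> \<kappa> ^ n"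
          using small[OF that] by (intro power_mono) (auto simp: h_def)
        then show ?thesis by (simp add: h_def norm_power norm_divide)
      qed
      have nc: "of_nat n * c = of_real ((real k + 1 / 2) * pi)"
        using elim(3) by (simp add: c_def node_def)
      have cosc: "cos ((real k + 1 / 2) * pi) = 0"
        using cos_int_times_real[of "int (2 * k + 1)"]
        by (simp add: distrib_right cos_add)
      have abs_sin: "\<bar>sin ((real k + 1 / 2) * pi)\<bar> = 1"
        using sin_cos_squared_add[of "(real k + 1 / 2) * pi"] cosc by (simp add: abs_square_eq_1)
      have edge: "m \<le> norm (cos (of_nat n * w))" if w: "norm (c - w) = 1 / n" for w
      proof -
        define v where "v = of_nat n * (w - c)"
        have "norm v = 1" using w elim(3) by (simp add: v_def norm_mult norm_minus_commute)
        have "cos (of_nat n * w) = cos (of_real ((real k + 1 / 2) * pi) + v)"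
          unfolding nc[symmetric] v_def by (simp add: algebra_simps)
        also have "\<dots> = - of_real (sin ((real k + 1 / 2) * pi)) * sin v"
          unfolding cos_add cos_of_real sin_of_real cosc by simp
        finally have "norm (cos (of_nat n * w)) = norm (sin v)"
          using abs_sin by (simp add: norm_mult)
        then show ?thesis using m(2)[OF \<open>norm v = 1\<close>] by simp
      qed
      have "\<exists>w. w \<in> ball c (1 / n) \<and> H w = 0"
      proof (rule holomorphic_contract_to_zero[of c "1 / n" H])
        show "continuous_on (cball c (1 / n)) H"
          using continuous_on_subset[OF holomorphic_on_imp_continuous_on[OF hol] sub] .
        show "H holomorphic_on ball c (1 / n)"
          using holomorphic_on_subset[OF hol] sub ball_subset_cball by blast
        show "0 < 1 / real n" using elim(3) by simp
        fix w assume w: "norm (c - w) = 1 / n"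
        have "norm (H c) \<le> \<kappa> ^ n"
          using pert[of c] elim(3) unfolding H_def nc cos_of_real cosc by simp
        also have "\<dots> < 2 * m - \<kappa> ^ n" using elim(1) by simp
        also have "\<dots> \<le> norm (2 * cos (of_nat n * w)) - norm ((- b / arc_sqrt b (cos w)) ^ n)"
          using edge[OF w] pert[of w] w by (simp add: dist_norm norm_mult)
        also have "\<dots> \<le> norm (H w)" unfolding H_def by (rule norm_triangle_ineq2)
        finally show "norm (H c) < norm (H w)" .
      qed auto
      then obtain w where w: "w \<in> ball c (1 / n)" "H w = 0" by blast
      have "2 * arc_sqrt b (cos w) ^ n * cos (of_nat n * w) = (- b) ^ n"
        using w(2) s0[of "cos w"] unfolding H_def power_divide by (simp add: field_simps)
      then have "poly (F n) (arc_param b (cos w)) = 0"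
        unfolding faber_polynomial_on_arc[OF R b F] by simp
      moreover have "cos w \<in> arc_domain b"
        using w(1) sub ball_subset_cball unfolding U_def by blast
      ultimately show "\<exists>w \<in> ball (of_real (pi * node n k)) (1 / real n).
          cos w \<in> arc_domain b \<and> poly (F n) (arc_param b (cos w)) = 0"
        using w(1) unfolding c_def by blast
    qed
  qed
qed

lemma cos_eq_in_strip:
  fixes w z :: complex
  assumes "cos w = cos z" "0 < Re w" "Re w < pi" "0 < Re z" "Re z < pi"
  shows "w = z"
proof -
  obtain k where k: "k \<in> \<int>" "w = z + of_real (2 * k * pi) \<or> w = - z + of_real (2 * k * pi)"
    using assms(1) unfolding complex_cos_eq by blast
  obtain i :: int where i: "k = of_int i" using k(1) by (auto elim: Ints_cases)
  from k(2) show ?thesis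
  proof
    assume w: "w = z + of_real (2 * k * pi)"
    then have "\<bar>(2 * k) * pi\<bar> < 1 * pi" using assms by auto
    then have "\<bar>2 * k\<bar> < 1" unfolding abs_mult by (simp add: mult_less_cancel_right2)
    then have "i = 0" unfolding i by linarith
    then show ?thesis using w i by simp
  next
    assume w: "w = - z + of_real (2 * k * pi)"
    then have "Re w + Re z = k * (2 * pi)" by simp
    then have "0 * (2 * pi) < k * (2 * pi)" "k * (2 * pi) < 1 * (2 * pi)" using assms by linarith+
    then have "0 < k" "k < 1"
      by (auto dest!: mult_right_less_imp_less simp: zero_less_mult_iff pi_not_less_zero)
    then have False unfolding i by simp
    then show ?thesis ..
  qed
qed

text \<open>The centre has distance at least \<pi>/(2n) > 1/n from 0 and \<pi>.\<close>

lemma node_strip: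
  assumes "k < n" "w \<in> ball (of_real (pi * node n k)) (1 / real n)"
  shows "0 < Re w" "Re w < pi"
proof -
  have n: "real n > 0" using assms(1) by simp
  have "\<bar>Re (of_real (pi * node n k) - w)\<bar> < 1 / real n"
    using assms(2) abs_Re_le_cmod[of "of_real (pi * node n k) - w"] by (simp add: dist_norm)
  then have *: "\<bar>pi * node n k - Re w\<bar> * n < 1" using n by (simp add: pos_less_divide_eq)
  then have "\<bar>(pi * node n k - Re w) * n\<bar> < 1" by (simp add: abs_mult)
  moreover have eq: "pi * node n k * n = pi * (real k + 1 / 2)" using n by (simp add: node_def)
  ultimately have **: "\<bar>pi * (real k + 1 / 2) - Re w * n\<bar> < 1"
    by (simp only: left_diff_distrib eq)
  have "3 / 2 < pi * (1 / 2)" using pi_gt3 by simp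
  moreover have "pi * (1 / 2) \<le> pi * (real k + 1 / 2)" by (intro mult_left_mono) auto
  moreover have "pi * (real k + 1 / 2) \<le> pi * (real n - 1 / 2)"
    using assms(1) by (intro mult_left_mono) auto
  moreover have "pi * (real n - 1 / 2) = pi * n - pi * (1 / 2)" by (simp add: right_diff_distrib)
  ultimately have "0 * n < Re w * n" "Re w * n < pi * n" using ** by linarith+
  then show "0 < Re w" "Re w < pi" using n
    by (auto dest!: mult_right_less_imp_less simp: zero_less_mult_iff)
qed

text \<open>Different centres have distance at least \<pi>/n > 2/n.\<close>

lemma node_balls_disjoint:
  assumes "w \<in> ball (complex_of_real (pi * node n j)) (1 / real n)"
    "w \<in> ball (of_real (pi * node n k)) (1 / real n)"
  shows "j = k"
proof -
  have n: "real n > 0" using assms(1) by (cases n) auto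
  have "dist (complex_of_real (pi * node n j)) (of_real (pi * node n k)) < 2 / real n"
    using dist_triangle[of "complex_of_real (pi * node n j)" "of_real (pi * node n k)" w] assms
    by (simp add: dist_commute)
  then have "\<bar>pi * node n j - pi * node n k\<bar> < 2 / real n"
    by (simp only: dist_of_real dist_real_def)
  moreover have "pi * node n j - pi * node n k = pi * (real j - real k) / n"
    using n by (simp add: node_def field_simps)
  ultimately have "pi * \<bar>real j - real k\<bar> < 2"
    using n by (simp add: abs_mult divide_less_cancel)
  moreover have "pi * 1 \<le> pi * \<bar>real j - real k\<bar>" if "1 \<le> \<bar>real j - real k\<bar>"
    using that by (intro mult_left_mono) auto
  ultimately have "\<not> 1 \<le> \<bar>real j - real k\<bar>" using pi_gt3 by linarith
  then show ?thesis by linarith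
qed

section \<open>Counting measures, Riemann sums and the arcsine law\<close>

text \<open>The mean value theorem for an antiderivative of G turns each increment over an interval of
length 1/n into a value of G at some point of that interval, which is uniformly close to the
value at the midpoint.\<close>

lemma riemann_midpoint_sums:
  fixes G :: "real \<Rightarrow> real"
  assumes G: "continuous_on {0..1} G"
  shows "(\<lambda>n. (\<Sum>k<n. G (node n k)) / real n) \<longlonglongrightarrow> integral {0..1} G"
proof (rule LIMSEQ_I)
  fix e :: real assume e: "e > 0"
  define A where "A = (\<lambda>x. integral {0..x} G)"
  have der: "(A has_real_derivative G x) (at x within {0..1})" if "x \<in> {0..1}" for x
    using integral_has_real_derivative[OF G that] by (simp add: A_def)
  have "uniformly_continuous_on {0..1} G" using G by (intro compact_uniformly_continuous) auto
  then obtain d where d: "d > 0"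
    "\<And>x y. x \<in> {0..1} \<Longrightarrow> y \<in> {0..1} \<Longrightarrow> dist y x < d \<Longrightarrow> dist (G y) (G x) < e"
    using e unfolding uniformly_continuous_on_def by meson
  obtain n0 where n0: "\<And>n. n \<ge> n0 \<Longrightarrow> 1 / real n < d"
    using order_tendstoD(2)[OF lim_1_over_n[where 'a = real], of d] d(1) unfolding eventually_sequentially by blast
  show "\<exists>n0. \<forall>n\<ge>n0. norm ((\<Sum>k<n. G (node n k)) / real n - integral {0..1} G) < e"
  proof (intro exI[of _ "max n0 1"] allI impI)
    fix n assume "max n0 1 \<le> n"
    then have n: "n > 0" "1 / real n < d" using n0 by auto
    have step: "\<bar>G (node n k) / n - (A (real (Suc k) / n) - A (real k / n))\<bar> < e / n"
      if k: "k < n" for k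
    proof -
      define l r where "l = real k / n" and "r = real (Suc k) / n"
      have lr: "0 \<le> l" "l < r" "r \<le> 1" "r - l = 1 / n"
        using k n by (auto simp: l_def r_def field_simps)
      have nd: "node n k \<in> {l..r}" using n by (simp add: node_def l_def r_def divide_right_mono)
      have cont: "continuous_on {l..r} A"
        using continuous_on_subset[OF DERIV_continuous_on[OF der], of "{l..r}"] lr by auto
      have "\<exists>\<xi>. l < \<xi> \<and> \<xi> < r \<and> A r - A l = (\<lambda>h. G \<xi> * h) (r - l)"
      proof (rule mvt[OF lr(2) cont])
        fix x assume "l < x" "x < r"
        then show "(A has_derivative (\<lambda>h. G x * h)) (at x)"
          using der[of x] lr by (simp add: has_field_derivative_def at_within_Icc_at)
      qed blast
      then obtain \<xi> where \<xi>: "l < \<xi>" "\<xi> < r" "A r - A l = G \<xi> * (1 / n)" using lr(4) by auto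
      have "dist (G (node n k)) (G \<xi>) < e"
        using nd lr \<xi> n(2) by (intro d(2)) (auto simp: dist_real_def)
      then have "\<bar>G (node n k) - G \<xi>\<bar> / n < e / n"
        using n by (simp add: dist_real_def divide_strict_right_mono)
      then show ?thesis
        using \<xi>(3) unfolding l_def r_def by (simp add: diff_divide_distrib[symmetric])
    qed
    have "(\<Sum>k<n. A (real (Suc k) / n) - A (real k / n)) = A 1 - A 0"
      using n by (subst sum_lessThan_telescope[of "\<lambda>k. A (real k / n)"]) simp
    also have "\<dots> = integral {0..1} G" by (simp add: A_def)
    finally have "(\<Sum>k<n. G (node n k)) / real n - integral {0..1} G
        = (\<Sum>k<n. G (node n k) / n - (A (real (Suc k) / n) - A (real k / n)))"
      by (simp add: sum_subtractf sum_divide_distrib)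
    also have "norm \<dots> \<le> (\<Sum>k<n. norm (G (node n k) / n - (A (real (Suc k) / n) - A (real k / n))))"
      by (rule norm_sum)
    also have "\<dots> < (\<Sum>k<n. e / n)"
      using step n by (intro sum_strict_mono) (auto simp: lessThan_empty_iff)
    also have "\<dots> = e" using n by simp
    finally show "norm ((\<Sum>k<n. G (node n k)) / real n - integral {0..1} G) < e" .
  qed
qed

lemma integral_zero_counting_measure:
  fixes f :: "complex \<Rightarrow> real"
  assumes "p \<noteq> 0" "f \<in> borel_measurable borel"
  shows "integral\<^sup>L (zero_counting_measure n p) f
    = (\<Sum>z | poly p z = 0. real (order z p) / real n * f z)"
proof -
  have "integral\<^sup>L (zero_counting_measure n p) f
      = integral\<^sup>L (point_measure {z. poly p z = 0} (\<lambda>z. ennreal (real (order z p) / real n))) f"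
    unfolding zero_counting_measure_def
    by (rule integral_distr) (use assms in \<open>auto simp: measurable_def\<close>)
  also have "\<dots> = (\<Sum>z | poly p z = 0. (real (order z p) / real n) *\<^sub>R f z)"
    by (rule lebesgue_integral_point_measure_finite) (use poly_roots_finite[OF assms(1)] in auto)
  finally show ?thesis by simp
qed

lemma sum_order_le_degree:
  fixes p :: "complex poly"
  assumes "p \<noteq> 0"
  shows "(\<Sum>z | poly p z = 0. order z p) \<le> degree p"
  using size_proots_le[of p] assms by (simp add: size_multiset_overloaded_eq)

text \<open>The chosen zeros account for mass (card I)/n, so at most 1 - (card I)/n of the mass is left, and it
enters with a factor of at most B.\<close>

lemma zero_counting_measure_approx:
  fixes f :: "complex \<Rightarrow> real" and \<zeta> :: "'i \<Rightarrow> complex"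
  assumes p: "p \<noteq> 0" "degree p \<le> n" and n: "n > 0"
    and f: "f \<in> borel_measurable borel" "\<And>z. \<bar>f z\<bar> \<le> B"
    and I: "finite I" "inj_on \<zeta> I" "\<And>i. i \<in> I \<Longrightarrow> poly p (\<zeta> i) = 0"
  shows "\<bar>integral\<^sup>L (zero_counting_measure n p) f - (\<Sum>i\<in>I. f (\<zeta> i)) / n\<bar>
    \<le> B * (1 - card I / n)"
proof -
  define Z where "Z = {z. poly p z = 0}"
  define c where "c z = real (order z p) - (if z \<in> \<zeta> ` I then 1 else 0)" for z
  have Z: "finite Z" unfolding Z_def by (rule poly_roots_finite[OF p(1)])
  have sub: "\<zeta> ` I \<subseteq> Z" using I(3) by (auto simp: Z_def)
  have c: "c z \<ge> 0" if "z \<in> Z" for z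
    using that order_gt_0_iff[OF p(1), of z] by (auto simp: c_def Z_def)
  have split: "(\<Sum>z\<in>Z. (if z \<in> \<zeta> ` I then 1 else 0) * g z) = (\<Sum>i\<in>I. g (\<zeta> i))" for g :: "complex \<Rightarrow> real"
  proof -
    have "(\<Sum>z\<in>Z. (if z \<in> \<zeta> ` I then 1 else 0) * g z) = (\<Sum>z\<in>Z. if z \<in> \<zeta> ` I then g z else 0)"
      by (intro sum.cong) auto
    also have "\<dots> = sum g (\<zeta> ` I)"
      using Z sub by (simp add: sum.inter_restrict[symmetric] Int_absorb1)
    also have "\<dots> = (\<Sum>i\<in>I. g (\<zeta> i))" using I(2) by (simp add: sum.reindex)
    finally show ?thesis .
  qed
  have "integral\<^sup>L (zero_counting_measure n p) f - (\<Sum>i\<in>I. f (\<zeta> i)) / n = (\<Sum>z\<in>Z. c z * f z) / n"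
    unfolding integral_zero_counting_measure[OF p(1) f(1)] split[symmetric] Z_def[symmetric]
    by (simp add: c_def left_diff_distrib sum_subtractf diff_divide_distrib sum_divide_distrib)
  then have "\<bar>integral\<^sup>L (zero_counting_measure n p) f - (\<Sum>i\<in>I. f (\<zeta> i)) / n\<bar>
      = \<bar>\<Sum>z\<in>Z. c z * f z\<bar> / n" by simp
  also have "\<dots> \<le> (\<Sum>z\<in>Z. c z * B) / n"
  proof (intro divide_right_mono order.trans[OF sum_abs] sum_mono)
    fix z assume "z \<in> Z"
    then show "\<bar>c z * f z\<bar> \<le> c z * B" using c f(2)[of z] by (simp add: abs_mult mult_left_mono)
  qed simp
  also have "(\<Sum>z\<in>Z. c z * B) = ((\<Sum>z\<in>Z. real (order z p)) - card I) * B"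
    using split[of "\<lambda>_. B"]
    by (simp add: c_def left_diff_distrib sum_subtractf sum_distrib_right)
  also have "\<dots> / n \<le> (real n - card I) * B / n"
  proof (intro divide_right_mono mult_right_mono)
    have "(\<Sum>z\<in>Z. order z p) \<le> n" using sum_order_le_degree[OF p(1)] p(2) by (simp add: Z_def)
    then have "real (\<Sum>z\<in>Z. order z p) \<le> real n" by (simp only: of_nat_le_iff)
    then show "(\<Sum>z\<in>Z. real (order z p)) - card I \<le> real n - card I" by simp
    show "0 \<le> B" using f(2)[of 0] by simp
  qed simp
  also have "\<dots> = B * (1 - card I / n)" using n by (simp add: field_simps)
  finally show ?thesis .
qed

definition arcsine_density :: "real \<Rightarrow> real" where
  "arcsine_density x = 1 / (pi * sqrt (1 - x\<^sup>2))"

text \<open>The density cancels the derivative of the substitution x = cos(\<pi> t). On [-1,0] this substitution is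
increasing, as required by the substitution rule. At the two end points the square root is zero, and so
is the density by the convention on division by zero.\<close>

lemma arcsine_density_cos:
  assumes "t \<in> {-1..0}"
  shows "arcsine_density (cos (pi * t)) * (- (pi * sin (pi * t))) = (if t \<in> {-1,0} then 0 else 1)"
proof (cases "t \<in> {-1,0}")
  case False
  then have "0 < sin (pi * (- t))"
    using assms mult_strict_left_mono[of "- t" 1 pi] by (intro sin_gt_zero) (auto simp: mult_pos_neg)
  then have s: "sin (pi * t) < 0" by simp
  have "1 - (cos (pi * t))\<^sup>2 = (sin (pi * t))\<^sup>2" by (simp add: sin_squared_eq)
  then have "sqrt (1 - (cos (pi * t))\<^sup>2) = - sin (pi * t)" using s by simp
  then show ?thesis using s False by (simp add: arcsine_density_def)
qed auto

lemma cos_substitution: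
  "t \<in> {-1..0} \<Longrightarrow> ((\<lambda>t. cos (pi * t)) has_real_derivative (- (pi * sin (pi * t)))) (at t)"
  "continuous_on {-1..0} (\<lambda>t. - (pi * sin (pi * t)))"
  "t \<in> {-1..0} \<Longrightarrow> 0 \<le> - (pi * sin (pi * t))"
proof -
  show "((\<lambda>t. cos (pi * t)) has_real_derivative (- (pi * sin (pi * t)))) (at t)"
    by (auto intro!: derivative_eq_intros)
  show "continuous_on {-1..0} (\<lambda>t. - (pi * sin (pi * t)))" by (intro continuous_intros)
  assume t: "t \<in> {-1..0}"
  then have "0 \<le> sin (pi * (- t))"
    using mult_left_mono[of "- t" 1 pi] by (intro sin_ge_zero) (auto simp: mult_nonneg_nonpos)
  then show "0 \<le> - (pi * sin (pi * t))" by (simp add: mult_nonneg_nonpos)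
qed

lemma arcsine_density_integrable: "set_integrable lborel {-1..1} arcsine_density"
proof -
  have meas: "arcsine_density \<in> borel_measurable borel"
    unfolding arcsine_density_def by measurable
  have sm: "set_borel_measurable borel {cos (pi * (- 1))..cos (pi * 0)} arcsine_density"
    unfolding set_borel_measurable_def using meas by measurable
  have "(\<integral>\<^sup>+x. ennreal (arcsine_density x * indicator {-1..1} x) \<partial>lborel)
      = (\<integral>\<^sup>+t. ennreal (arcsine_density (cos (pi * t)) * (- (pi * sin (pi * t))) * indicator {-1..0} t) \<partial>lborel)"
    using nn_integral_substitution[OF sm cos_substitution] by simp
  also have "\<dots> \<le> (\<integral>\<^sup>+t. indicator {-1..0::real} t \<partial>lborel)"
  proof (rule nn_integral_mono)
    fix t :: real
    show "ennreal (arcsine_density (cos (pi * t)) * (- (pi * sin (pi * t))) * indicator {-1..0} t)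
        \<le> indicator {-1..0} t"
      using arcsine_density_cos[of t] by (cases "t \<in> {-1..0}") (simp_all split: if_splits)
  qed
  also have "\<dots> < \<infinity>" by simp
  finally have fin: "(\<integral>\<^sup>+x. ennreal (arcsine_density x * indicator {-1..1} x) \<partial>lborel) < \<infinity>" .
  have pos: "0 \<le> arcsine_density x * indicator {-1..1} x" for x
    by (auto simp: arcsine_density_def indicator_def abs_square_le_1 abs_le_iff)
  have "integrable lborel (\<lambda>x. arcsine_density x * indicator {-1..1} x)"
    by (rule integrableI_nonneg) (use meas pos fin in auto)
  then show ?thesis unfolding set_integrable_def by (simp add: mult.commute)
qed

text \<open>The arcsine law is the distribution of cos(\<pi> t) for t uniform on [0,1].\<close>

lemma integral_equilibrium_measure:
  fixes h :: "real \<Rightarrow> real"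
  assumes h: "continuous_on {-1..1} h"
  shows "integral\<^sup>L equilibrium_measure h = integral {0..1} (\<lambda>t. h (cos (pi * t)))"
proof -
  define H where "H x = arcsine_density x * h x" for x
  have hm: "h \<in> borel_measurable (restrict_space lborel {-1..1})"
    using borel_measurable_continuous_on_restrict[OF h] by (simp cong: measurable_cong_sets add: sets_restrict_space)
  have "bounded (h ` {-1..1})" using h by (intro compact_imp_bounded compact_continuous_image) auto
  then obtain B where B: "\<forall>x\<in>{-1..1}. \<bar>h x\<bar> \<le> B" unfolding bounded_iff by auto
  have "set_integrable lborel {-1..1} H"
    unfolding H_def set_integrable_def
  proof (rule Bochner_Integration.integrable_bound)
    show "integrable lborel (\<lambda>x. B * (indicator {-1..1} x *\<^sub>R arcsine_density x))"
      using arcsine_density_integrable unfolding set_integrable_def by (intro integrable_mult_right)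
    have "(\<lambda>x. indicator {-1..1} x *\<^sub>R h x) \<in> borel_measurable lborel"
      using hm by (subst (asm) borel_measurable_restrict_space_iff) auto
    moreover have "arcsine_density \<in> borel_measurable lborel" unfolding arcsine_density_def by measurable
    ultimately have "(\<lambda>x. arcsine_density x * (indicator {-1..1} x *\<^sub>R h x)) \<in> borel_measurable lborel"
      by measurable
    then show "(\<lambda>x. indicator {-1..1} x *\<^sub>R (arcsine_density x * h x)) \<in> borel_measurable lborel"
      by (simp add: ac_simps)
    show "AE x in lborel. norm (indicator {-1..1} x *\<^sub>R (arcsine_density x * h x))
        \<le> norm (B * (indicator {-1..1} x *\<^sub>R arcsine_density x))"
    proof (rule AE_I2)
      fix x :: real
      show "norm (indicator {-1..1} x *\<^sub>R (arcsine_density x * h x))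
          \<le> norm (B * (indicator {-1..1} x *\<^sub>R arcsine_density x))"
      proof (cases "x \<in> {-1..1}")
        case True
        then have "\<bar>h x\<bar> \<le> \<bar>B\<bar>" using B by force
        then show ?thesis
          using True by (simp add: abs_mult mult.commute[of "\<bar>B\<bar>"] mult_left_mono)
      qed simp
    qed
  qed
  then have HI: "set_integrable lborel {cos (pi * (- 1))..cos (pi * 0)} H" by simp
  have "integral\<^sup>L equilibrium_measure h
      = integral\<^sup>L (restrict_space lborel {-1..1}) (\<lambda>x. arcsine_density x *\<^sub>R h x)"
    unfolding equilibrium_measure_def arcsine_density_def[symmetric]
  proof (rule integral_density[OF hm])
    show "arcsine_density \<in> borel_measurable (restrict_space lborel {-1..1})"
      unfolding arcsine_density_def by (intro measurable_restrict_space1) measurable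
    show "AE x in restrict_space lborel {-1..1}. 0 \<le> arcsine_density x"
      by (rule AE_I2) (auto simp: arcsine_density_def space_restrict_space abs_square_le_1 abs_le_iff)
  qed
  also have "\<dots> = (LBINT x. H x * indicator {cos (pi * (- 1))..cos (pi * 0)} x)"
    by (subst integral_restrict_space) (auto simp: H_def mult.commute)
  also have "\<dots> = (LBINT t. H (cos (pi * t)) * (- (pi * sin (pi * t))) * indicator {-1..0} t)"
    by (rule integral_substitution(2)[OF HI cos_substitution]) auto
  also have "\<dots> = (LINT t : {-1..0} | lborel. H (cos (pi * t)) * (- (pi * sin (pi * t))))"
    unfolding set_lebesgue_integral_def by (simp add: mult.commute)
  also have "\<dots> = integral {-1..0} (\<lambda>t. H (cos (pi * t)) * (- (pi * sin (pi * t))))"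
    by (rule set_borel_integral_eq_integral(2)[OF integral_substitution(1)[OF HI cos_substitution]]) auto
  also have "\<dots> = integral {-1..0} (\<lambda>t. h (cos (pi * t)))"
  proof (rule integral_spike[of "{-1,0}"])
    fix t :: real assume "t \<in> {-1..0} - {-1,0}"
    then have "arcsine_density (cos (pi * t)) * (- (pi * sin (pi * t))) = 1"
      using arcsine_density_cos[of t] by simp
    moreover have "H (cos (pi * t)) * (- (pi * sin (pi * t)))
        = arcsine_density (cos (pi * t)) * (- (pi * sin (pi * t))) * h (cos (pi * t))"
      unfolding H_def by (simp only: ac_simps)
    ultimately show "h (cos (pi * t)) = H (cos (pi * t)) * (- (pi * sin (pi * t)))" by simp
  qed auto
  also have "\<dots> = integral {0..1} (\<lambda>t. h (cos (pi * t)))"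
    using Henstock_Kurzweil_Integration.integral_reflect_real[of 1 0 "\<lambda>t. h (cos (pi * t))"] by simp
  finally show ?thesis .
qed

lemma integral_limit_measure:
  fixes f :: "complex \<Rightarrow> real"
  assumes b: "b\<^sup>2 \<noteq> 1" "Re b \<noteq> 0" "Im b \<noteq> 0" and S: "airfoil_sqrt_branch b S"
    and f: "continuous_on UNIV f"
  shows "integral\<^sup>L (distr equilibrium_measure borel (airfoil_U_inv b S)) f
    = integral {0..1} (\<lambda>t. f (arc_param b (cos (of_real (pi * t)))))"
proof -
  define g where "g x = arc_param b (complex_of_real x)" for x
  have g: "continuous_on {-1..1} g" unfolding g_def
    by (rule continuous_on_compose2[OF holomorphic_on_imp_continuous_on[OF holomorphic_on_arc_param]])
      (auto intro: continuous_intros segment_in_arc_domain[OF b(2,3)])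
  have space: "space equilibrium_measure = {-1..1}"
    by (simp add: equilibrium_measure_def space_restrict_space)
  have sets: "sets equilibrium_measure = sets (restrict_space borel {-1..1})"
    by (simp add: equilibrium_measure_def sets_restrict_space)
  have eq: "airfoil_U_inv b S x = g x" if "x \<in> {-1..1}" for x
    using airfoil_U_inv_eq[OF b S that] by (simp add: g_def)
  have "g \<in> measurable equilibrium_measure borel"
    using borel_measurable_continuous_on_restrict[OF g] by (simp cong: measurable_cong_sets add: sets)
  then have "airfoil_U_inv b S \<in> measurable equilibrium_measure borel"
    using eq space by (subst measurable_cong[of _ _ g]) auto
  then have "integral\<^sup>L (distr equilibrium_measure borel (airfoil_U_inv b S)) f
      = integral\<^sup>L equilibrium_measure (\<lambda>x. f (airfoil_U_inv b S x))"
    by (intro integral_distr borel_measurable_continuous_onI f)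
  also have "\<dots> = integral\<^sup>L equilibrium_measure (\<lambda>x. f (g x))"
    using eq space by (intro Bochner_Integration.integral_cong) auto
  also have "\<dots> = integral {0..1} (\<lambda>t. f (g (cos (pi * t))))"
    by (intro integral_equilibrium_measure continuous_on_compose2[OF f g]) auto
  finally show ?thesis by (simp only: g_def cos_of_real)
qed

section \<open>Limit distribution of the zeros\<close>

text \<open>With m about \<eta> n, there are n - 2 m distinct zeros near the nodes with m \<le> k < n - m. Discarding
all other zeros from \<mu>_n, moving these to the points of the arc that belong to the nodes, and
adding the points of the missing nodes changes the integral of the test function by O(\<eta>)
plus a term that tends to zero.\<close>

lemma faber_zeros_weak_limit:
  assumes R: "1 < R * cos \<theta>" and b: "b = airfoil_b R \<theta>"
    and b': "\<bar>Re b\<bar> \<le> 1 / 2" "b\<^sup>2 \<noteq> 1" "Re b \<noteq> 0" "Im b \<noteq> 0"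
    and F: "faber_polynomials K (airfoil_map R \<theta>) F" and S: "airfoil_sqrt_branch b S"
  shows "weak_star_limit (\<lambda>n. zero_counting_measure n (F n))
           (distr equilibrium_measure borel (airfoil_U_inv b S))"
  unfolding weak_star_limit_def
proof (intro allI impI)
  fix f :: "complex \<Rightarrow> real"
  assume f: "continuous_on UNIV f \<and> bounded (range f)"
  then obtain B0 where "\<And>z. \<bar>f z\<bar> \<le> B0" unfolding bounded_iff by auto
  then have B: "\<bar>f z\<bar> \<le> \<bar>B0\<bar> + 1" for z by (meson abs_ge_self add_increasing2 order_trans zero_le_one)
  define B where "B = \<bar>B0\<bar> + 1"
  have B: "B > 0" "\<And>z. \<bar>f z\<bar> \<le> B" using B by (auto simp: B_def)
  define U where "U = {w. cos w \<in> arc_domain b}"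
  define h where "h w = f (arc_param b (cos w))" for w
  define C where "C = (\<lambda>t. complex_of_real (pi * t)) ` {0..1}"
  define I where "I n = integral\<^sup>L (zero_counting_measure n (F n)) f" for n
  define M where "M = (\<lambda>n. (\<Sum>k<n. h (of_real (pi * node n k))) / real n)"
  have hU: "continuous_on U h" unfolding h_def U_def
    using f by (intro continuous_on_compose2[OF _ continuous_on_arc_functions(1)]) auto
  have C: "compact C" unfolding C_def by (intro compact_continuous_image continuous_intros) auto
  have CU: "C \<subseteq> U"
  proof
    fix w assume "w \<in> C"
    then obtain t where "w = of_real (pi * t)" by (auto simp: C_def)
    then have "cos w = of_real (cos (pi * t))" by (simp only: cos_of_real)
    then show "w \<in> U"
      using segment_in_arc_domain[OF b'(3,4), of "cos (pi * t)"] by (simp add: U_def)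
  qed
  have "(\<lambda>n. (\<Sum>k<n. (\<lambda>t. h (of_real (pi * t))) (node n k)) / real n)
      \<longlonglongrightarrow> integral {0..1} (\<lambda>t. h (of_real (pi * t)))"
    by (rule riemann_midpoint_sums, rule continuous_on_compose2[OF hU])
      (use CU in \<open>auto intro!: continuous_intros simp: C_def\<close>)
  then have lim: "M \<longlonglongrightarrow> integral\<^sup>L (distr equilibrium_measure borel (airfoil_U_inv b S)) f"
    using integral_limit_measure[OF b'(2-4) S] f by (simp add: M_def h_def)
  have "(\<lambda>n. I n - M n) \<longlonglongrightarrow> 0"
  proof (rule tendstoI)
    fix e :: real assume e: "e > 0"
    \<comment> \<open>The part of the mass left out is at most 2 \<eta> + 2/n; it is counted twice, with the factor B.\<close>
    define \<eta> where "\<eta> = e / (16 * B)"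
    have \<eta>: "\<eta> > 0" using e B(1) by (simp add: \<eta>_def)
    obtain d where d: "d > 0"
      "\<And>x y. x \<in> C \<Longrightarrow> dist x y < d \<Longrightarrow> y \<in> U \<and> dist (h x) (h y) < e / 4"
      using uniformly_close_to_compact[OF C CU continuous_on_arc_functions(3)[of b, folded U_def] hU, of "e / 4"] e
      by auto
    have ev1: "\<forall>\<^sub>F n in sequentially. 1 / real n < min d (e / (16 * B))"
      using order_tendstoD(2)[OF lim_1_over_n[where 'a = real], of "min d (e / (16 * B))"] d(1) e B(1) by simp
    from faber_zeros_near_nodes[OF R b b' F \<eta>] ev1 eventually_gt_at_top[of 0]
    show "\<forall>\<^sub>F n in sequentially. dist (I n - M n) 0 < e"
    proof eventually_elim
      case (elim n)
      define m where "m = nat \<lceil>\<eta> * n\<rceil>"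
      define G where "G = {m..<n - m}"
      have n: "real n > 0" using elim(3) by simp
      have "real m = of_int \<lceil>\<eta> * n\<rceil>" using \<eta> by (simp add: m_def)
      then have m: "\<eta> * n \<le> m" "m \<le> \<eta> * n + 1" by linarith+
      have Gn: "G \<subseteq> {..<n}" by (auto simp: G_def)
      have inner: "\<eta> \<le> node n k" "node n k \<le> 1 - \<eta>" if k: "k \<in> G" for k
      proof -
        have "m \<le> k" "k + m < n" using k by (auto simp: G_def)
        then have "real m \<le> real k" "real k + real m + 1 \<le> real n" by linarith+
        then have "\<eta> * n \<le> real k + 1 / 2" "real k + 1 / 2 \<le> (1 - \<eta>) * n"
          using m(1) unfolding left_diff_distrib by linarith+
        then show "\<eta> \<le> node n k" "node n k \<le> 1 - \<eta>"
          using n by (simp_all add: node_def pos_le_divide_eq pos_divide_le_eq)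
      qed
      then have "\<forall>k\<in>G. \<exists>w. w \<in> ball (of_real (pi * node n k)) (1 / real n) \<and>
          cos w \<in> arc_domain b \<and> poly (F n) (arc_param b (cos w)) = 0"
        using elim(1) by blast
      then obtain w where w: "\<And>k. k \<in> G \<Longrightarrow> w k \<in> ball (of_real (pi * node n k)) (1 / real n)"
        "\<And>k. k \<in> G \<Longrightarrow> cos (w k) \<in> arc_domain b"
        "\<And>k. k \<in> G \<Longrightarrow> poly (F n) (arc_param b (cos (w k))) = 0"
        by metis
      have inj: "inj_on (\<lambda>k. arc_param b (cos (w k))) G"
      proof (rule inj_onI)
        fix j k assume jk: "j \<in> G" "k \<in> G" "arc_param b (cos (w j)) = arc_param b (cos (w k))"
        have c: "cos (w j) = cos (w k)"
          using inj_onD[OF inj_on_arc_param[OF b'(2)] jk(3)] w(2) jk(1,2) by blast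
        have lt: "j < n" "k < n" using jk Gn by auto
        have "w j = w k"
          by (rule cos_eq_in_strip[OF c node_strip[OF lt(1) w(1)[OF jk(1)]]
              node_strip[OF lt(2) w(1)[OF jk(2)]]])
        then show "j = k"
          using node_balls_disjoint[OF w(1)[OF jk(1)]] w(1)[OF jk(2)] by simp
      qed
      have deg: "degree (F n) = n" using degree_faber_polynomial[OF R F] elim(3) by simp
      have "F n \<noteq> 0" using deg elim(3) by auto
      then have 1: "\<bar>I n - (\<Sum>k\<in>G. h (w k)) / n\<bar> \<le> B * (1 - card G / n)"
        unfolding I_def h_def
      proof (rule zero_counting_measure_approx)
        show "f \<in> borel_measurable borel" using f by (auto intro: borel_measurable_continuous_onI)
        show "finite G" by (simp add: G_def)
      qed (use deg elim(3) B(2) w(3) inj in auto)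
      have sumM: "M n = ((\<Sum>k\<in>G. h (of_real (pi * node n k))) + (\<Sum>k\<in>{..<n} - G. h (of_real (pi * node n k)))) / n"
        unfolding M_def using sum.subset_diff[OF Gn, of "\<lambda>k. h (of_real (pi * node n k))"] by (simp add: add.commute)
      have "\<bar>\<Sum>k\<in>{..<n} - G. h (of_real (pi * node n k))\<bar> \<le> (\<Sum>k\<in>{..<n} - G. B)"
        by (rule order.trans[OF sum_abs sum_mono]) (simp add: h_def B(2))
      also have "\<dots> = B * (real n - card G)"
        using Gn card_mono[OF _ Gn] by (simp add: card_Diff_subset finite_subset[OF Gn])
      finally have "\<bar>\<Sum>k\<in>{..<n} - G. h (of_real (pi * node n k))\<bar> / n \<le> B * (real n - card G) / n"
        using n by (simp add: divide_right_mono)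
      then have 2: "\<bar>(\<Sum>k\<in>{..<n} - G. h (of_real (pi * node n k))) / n\<bar> \<le> B * (1 - card G / n)"
        using n by (simp add: diff_divide_distrib right_diff_distrib)
      have "\<bar>(\<Sum>k\<in>G. h (w k)) - (\<Sum>k\<in>G. h (of_real (pi * node n k)))\<bar>
          \<le> (\<Sum>k\<in>G. e / 4)"
        unfolding sum_subtractf[symmetric]
      proof (rule order.trans[OF sum_abs sum_mono])
        fix k assume k: "k \<in> G"
        have "of_real (pi * node n k) \<in> C"
          using inner[OF k] \<eta> unfolding C_def by (intro image_eqI[of _ _ "node n k"]) auto
        moreover have "dist (of_real (pi * node n k)) (w k) < d" using w(1)[OF k] elim(2) by simp
        ultimately have "dist (h (of_real (pi * node n k))) (h (w k)) < e / 4" using d(2) by blast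
        then show "\<bar>h (w k) - h (of_real (pi * node n k))\<bar> \<le> e / 4"
          unfolding dist_real_def by linarith
      qed
      also have "\<dots> \<le> n * (e / 4)"
        using card_mono[OF _ Gn] e by (simp add: mult_right_mono)
      finally have "\<bar>(\<Sum>k\<in>G. h (w k)) - (\<Sum>k\<in>G. h (of_real (pi * node n k)))\<bar> / n \<le> e / 4"
        using n by (simp add: pos_divide_le_eq mult.commute)
      then have 3: "\<bar>(\<Sum>k\<in>G. h (w k)) / n - (\<Sum>k\<in>G. h (of_real (pi * node n k))) / n\<bar> \<le> e / 4"
        by (simp flip: diff_divide_distrib)
      have "B * (1 - card G / n) < e / 4"
      proof -
        have "real n - card G \<le> 2 * m" by (simp add: G_def)
        then have "real n - card G \<le> 2 * \<eta> * n + 2" using m(2) by linarith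
        then have "(real n - card G) / n \<le> (2 * \<eta> * n + 2) / n" by (rule divide_right_mono) simp
        then have "1 - card G / n \<le> 2 * \<eta> + 2 * (1 / n)"
          using n by (simp add: diff_divide_distrib add_divide_distrib)
        then have "1 - card G / n < 4 * \<eta>" using elim(2) by (simp add: \<eta>_def)
        then have "B * (1 - card G / n) < B * (4 * \<eta>)" using B(1) by (rule mult_strict_left_mono)
        then show ?thesis using B(1) by (simp add: \<eta>_def)
      qed
      then have "\<bar>I n - M n\<bar> < e"
        using 1 2 3 e unfolding sumM add_divide_distrib by linarith
      then show ?case by (simp add: dist_real_def)
    qed
  qed
  from tendsto_add[OF this lim]
  show "(\<lambda>n. integral\<^sup>L (zero_counting_measure n (F n)) f)
      \<longlonglongrightarrow> integral\<^sup>L (distr equilibrium_measure borel (airfoil_U_inv b S)) f"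
    by (simp add: I_def)
qed

theorem theorem4p1:
  fixes R \<theta> :: real and b :: complex and S :: "complex \<Rightarrow> complex" and F :: "nat \<Rightarrow> complex poly"
  assumes "R > 1" and "- pi / 2 < \<theta>" and "\<theta> < pi / 2" and "\<theta> \<noteq> 0"
    and "1 < R * cos \<theta>" and "R * cos \<theta> \<le> 3 / 2"
    and "b = airfoil_b R \<theta>"
    and "faber_polynomials (joukowski_airfoil R \<theta>) (airfoil_map R \<theta>) F"
    and "airfoil_sqrt_branch b S"
  shows "(\<forall>N. open N \<and> airfoil_arc b \<subseteq> N \<longrightarrow>
            (\<forall>\<^sub>F n in sequentially. \<forall>z. poly (F n) z = 0 \<longrightarrow> z \<in> N)) \<and>
         weak_star_limit (\<lambda>n. zero_counting_measure n (F n))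
           (distr equilibrium_measure borel (airfoil_U_inv b S))"
proof -
  have b: "Re b = 1 - R * cos \<theta>" "Im b = - (R * sin \<theta>)"
    unfolding assms(7) airfoil_b_def by (simp_all flip: cis_conv_exp)
  have "sin \<theta> \<noteq> 0" using assms(2-4) by (auto dest!: sin_eq_0_pi[rotated 2])
  then have Im: "Im b \<noteq> 0" using assms(1) by (simp add: b)
  have Re: "\<bar>Re b\<bar> \<le> 1 / 2" "Re b \<noteq> 0" using assms(5,6) by (auto simp: b)
  have "b\<^sup>2 \<noteq> 1"
  proof
    assume "b\<^sup>2 = 1"
    then have "b = 1 \<or> b = - 1" by (simp add: power2_eq_1_iff)
    then show False using Im by auto
  qed
  with Re Im assms show ?thesis
    using faber_zeros_near_arc[OF assms(5-7) _ assms(8)]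
      faber_zeros_weak_limit[OF assms(5,7) _ _ _ _ assms(8,9)] by blast
qed

end
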